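(* Let $\Lambda$ be the $2$-graph with one vertex $v$, two edges $f_1,f_2$ of degree $e_1$, one edge $e$ of degree $e_2$, and factorization rules $f_1e=ef_2$, $f_2e=ef_1$. Fix $x\in(0,1)$, let $T_x=(T_{i,j})_{i,j\in\{0,1\}}=\begin{pmatrix}x&1-x\\1-x&x\end{pmatrix}$, and let $\mu_x$ be the Markov measure given by $T_x$ and the vector $(1,1)$, viewed as a Borel measure on $\Lambda^\infty$; that is, for $a_1,\dots,a_n\in\{0,1\}$, $$\mu_x\big(Z(ef_{a_1+1}ef_{a_2+1}\cdots ef_{a_n+1})\big)=T_{a_1,a_2}T_{a_2,a_3}\cdots T_{a_{n-1},a_n}.$$ Then, with respect to $\mu_x$, the standard prefixing maps $\sigma_e,\sigma_{f_1},\sigma_{f_2}$ have positive Radon--Nikodym derivatives $\frac{d(\mu_x\circ\sigma_g)}{d\mu_x}(z)$, $g\in\{e,f_1,f_2\}$, at any point $z\in\Lambda^\infty$. Consequently, the standard prefixing and coding maps make $(\Lambda^\infty,\mu_x)$ into a $\Lambda$-semibranching function system.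
   Context: $\mathbb N=\{0,1,2,\dots\}$. A $k$-graph is a countable small category $\Lambda$ with a degree functor $d:\Lambda\to\mathbb N^k$ such that if $d(\lambda)=m+n$ there are unique $\mu,\nu$ with $\lambda=\mu\nu$, $d(\mu)=m$, $d(\nu)=n$. $\Lambda^n=d^{-1}(n)$; $\Lambda^0$ is the set of objects (vertices); $r,s$ are range and source; $s(\lambda)\Lambda=\{\nu:r(\nu)=s(\lambda)\}$. $\Omega_k$ is the $k$-graph with objects $\mathbb N^k$, morphisms $\{(p,q):p\le q\}$, $r(p,q)=p$, $s(p,q)=q$, $d(p,q)=q-p$. $\Lambda^\infty$ is the set of degree-preserving functors $x:\Omega_k\to\Lambda$ (infinite paths), $r(x)=x(0)$, with the topology whose basis is the cylinder sets $Z(\lambda)=\{x\in\Lambda^\infty:x(0,d(\lambda))=\lambda\}$. For the $2$-graph of the claim, $(a_i)_{i\ge1}\mapsto ef_{a_1+1}ef_{a_2+1}\cdots$ is a homeomorphism $\prod_{i\ge1}\{0,1\}\to\Lambda^\infty$. Standard coding maps: $\sigma^m(x)(p,q)=x(p+m,q+m)$, $m\in\mathbb N^k$. Standard prefixing maps: $\sigma_\lambda:Z(s(\lambda))\to Z(\lambda)$, $\sigma_\lambda(x)=\lambda x$ (the infinite path with initial segment $\lambda$ and $\sigma^{d(\lambda)}(\lambda x)=x$); $D_\lambda=Z(s(\lambda))$, $R_\lambda=Z(\lambda)$. $(\mu\circ\sigma_\lambda)(E)=\mu(\sigma_\lambda(E))$. Semibranching function system: finitely many measurable maps $\sigma_i:D_i\to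 X$, $D_i\subset X$ measurable, such that with $R_i=\sigma_i(D_i)$: $\mu(X\setminus\bigcup_iR_i)=0$, $\mu(R_i\cap R_j)=0$ for $i\ne j$, and $\frac{d(\mu\circ\sigma_i)}{d\mu}>0$ $\mu$-a.e. on $D_i$. A measurable $\sigma:X\to X$ is a coding map if $\sigma\circ\sigma_i(x)=x$ for $x\in D_i$. A $\Lambda$-semibranching function system on $(X,\mu)$ ($\Lambda$ a finite $k$-graph, i.e. all $\Lambda^n$ finite) consists of measurable sets $\{D_\lambda\}_{\lambda\in\Lambda}$, prefixing maps $\tau_\lambda:D_\lambda\to X$ and coding maps $\tau^m:X\to X$ ($m\in\mathbb N^k$) with: (a) for each $m$, $\{\tau_\lambda:d(\lambda)=m\}$ is a semibranching function system with coding map $\tau^m$; (b) $\tau_v=\mathrm{id}$, $\mu(D_v)>0$ for $v\in\Lambda^0$; (c) with $R_\lambda=\tau_\lambda(D_\lambda)$, for $\nu\in s(\lambda)\Lambda$, $R_\nu\subseteq D_\lambda$ up to a null set and $\tau_\lambda\tau_\nu=\tau_{\lambda\nu}$ a.e.; (d) $\tau^m\circ\tau^n=\tau^{m+n}$. *)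

theory Defs
  imports "HOL-Analysis.Analysis"
begin

text \<open>
  A small category is given by its morphisms only: an object is identified with its identity
  morphism, so that range and source take values in the identity morphisms. The degrees in
  \<open>\<nat>\<^sup>k\<close> are elements of \<^typ>\<open>nat ^ 'k\<close>, whose order is componentwise. The functions of
  the record are only meaningful on morphisms, and \<open>cmp\<close> only on composable pairs.
\<close>

record ('a, 'k) graded_category =
  mor :: "'a set"
  rng :: "'a \<Rightarrow> 'a"
  src :: "'a \<Rightarrow> 'a"
  cmp :: "'a \<Rightarrow> 'a \<Rightarrow> 'a"
  deg :: "'a \<Rightarrow> nat ^ 'k"

definition composable :: "('a, 'k::finite) graded_category \<Rightarrow> 'a \<Rightarrow> 'a \<Rightarrow> bool" where
  "composable L a b \<longleftrightarrow> a \<in> mor L \<and> b \<in> mor L \<and> src L a = rng L b"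

definition small_category :: "('a, 'k::finite) graded_category \<Rightarrow> bool" where
  "small_category L \<longleftrightarrow>
     (\<forall>a \<in> mor L. rng L a \<in> mor L \<and> src L a \<in> mor L
        \<and> rng L (rng L a) = rng L a \<and> src L (rng L a) = rng L a
        \<and> rng L (src L a) = src L a \<and> src L (src L a) = src L a
        \<and> cmp L (rng L a) a = a \<and> cmp L a (src L a) = a) \<and>
     (\<forall>a b. composable L a b \<longrightarrow>
        cmp L a b \<in> mor L \<and> rng L (cmp L a b) = rng L a \<and> src L (cmp L a b) = src L b) \<and>
     (\<forall>a b c. composable L a b \<and> composable L b c \<longrightarrow>
        cmp L (cmp L a b) c = cmp L a (cmp L b c))"

definition degree_functor :: "('a, 'k::finite) graded_category \<Rightarrow> bool" where
  "degree_functor L \<longleftrightarrow>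
     (\<forall>a \<in> mor L. deg L (rng L a) = 0 \<and> deg L (src L a) = 0) \<and>
     (\<forall>a b. composable L a b \<longrightarrow> deg L (cmp L a b) = deg L a + deg L b)"

definition k_graph :: "('a, 'k::finite) graded_category \<Rightarrow> bool" where
  "k_graph L \<longleftrightarrow>
     countable (mor L) \<and> small_category L \<and> degree_functor L \<and>
     (\<forall>l \<in> mor L. \<forall>m n. deg L l = m + n \<longrightarrow>
        (\<exists>!(a, b). composable L a b \<and> l = cmp L a b \<and> deg L a = m \<and> deg L b = n))"

definition deg_set :: "('a, 'k::finite) graded_category \<Rightarrow> nat ^ 'k \<Rightarrow> 'a set" where
  "deg_set L n = {l \<in> mor L. deg L l = n}"

abbreviation vertices :: "('a, 'k::finite) graded_category \<Rightarrow> 'a set" where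
  "vertices L \<equiv> deg_set L 0"

definition finite_k_graph :: "('a, 'k::finite) graded_category \<Rightarrow> bool" where
  "finite_k_graph L \<longleftrightarrow> k_graph L \<and> (\<forall>n. finite (deg_set L n))"

text \<open>The object \<open>p\<close> of \<open>Omega\<close> is the identity morphism \<open>(p, p)\<close>.\<close>

definition Omega :: "((nat ^ 'k::finite) \<times> (nat ^ 'k), 'k) graded_category" where
  "Omega = \<lparr>mor = {(p, q). p \<le> q}, rng = (\<lambda>(p, q). (p, p)), src = (\<lambda>(p, q). (q, q)),
            cmp = (\<lambda>(p, q) (p', q'). (p, q')), deg = (\<lambda>(p, q). q - p)\<rparr>"

definition degree_preserving_functor ::
    "('b, 'k::finite) graded_category \<Rightarrow> ('a, 'k::finite) graded_category \<Rightarrow> ('b \<Rightarrow> 'a) \<Rightarrow> bool" where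
  "degree_preserving_functor K L x \<longleftrightarrow>
     (\<forall>a \<in> mor K. x a \<in> mor L \<and> deg L (x a) = deg K a
        \<and> x (rng K a) = rng L (x a) \<and> x (src K a) = src L (x a)) \<and>
     (\<forall>a b. composable K a b \<longrightarrow> x (cmp K a b) = cmp L (x a) (x b))"

type_synonym ('a, 'k) path = "(nat ^ 'k) \<times> (nat ^ 'k) \<Rightarrow> 'a"

text \<open>
  Infinite paths are required to be \<^const>\<open>undefined\<close> at the pairs that are not morphisms of
  \<open>Omega\<close>, so that equality of functions is equality of infinite paths.
\<close>

definition inf_paths :: "('a, 'k::finite) graded_category \<Rightarrow> ('a, 'k) path set" where
  "inf_paths L = {x \<in> extensional (mor Omega). degree_preserving_functor Omega L x}"

definition cylinder :: "('a, 'k::finite) graded_category \<Rightarrow> 'a \<Rightarrow> ('a, 'k) path set" where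
  "cylinder L l = {x \<in> inf_paths L. x (0, deg L l) = l}"

definition path_topology :: "('a, 'k::finite) graded_category \<Rightarrow> ('a, 'k) path topology" where
  "path_topology L = topology_generated_by (cylinder L ` mor L)"

definition path_borel :: "('a, 'k::finite) graded_category \<Rightarrow> ('a, 'k) path measure" where
  "path_borel L = sigma (inf_paths L) {U. openin (path_topology L) U}"

definition std_coding :: "nat ^ 'k::finite \<Rightarrow> ('a, 'k) path \<Rightarrow> ('a, 'k) path" where
  "std_coding m x = restrict (\<lambda>(p, q). x (p + m, q + m)) (mor Omega)"

definition std_prefixing ::
    "('a, 'k::finite) graded_category \<Rightarrow> 'a \<Rightarrow> ('a, 'k) path \<Rightarrow> ('a, 'k) path" where
  "std_prefixing L l x = (THE y. y \<in> cylinder L l \<and> std_coding (deg L l) y = x)"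

definition std_domain :: "('a, 'k::finite) graded_category \<Rightarrow> 'a \<Rightarrow> ('a, 'k) path set" where
  "std_domain L l = cylinder L (src L l)"

text \<open>
  \<open>h\<close> is a version of the Radon--Nikodym derivative \<open>d(\<mu> \<circ> \<sigma>)/d\<mu>\<close> on the domain \<open>D\<close> of \<open>\<sigma>\<close>,
  where \<open>(\<mu> \<circ> \<sigma>)(E) = \<mu>(\<sigma>(E))\<close>. The measurability of the sets \<open>\<sigma>(E)\<close> is part of this, as
  \<open>\<mu> \<circ> \<sigma>\<close> has to be defined on all measurable subsets of \<open>D\<close>.
\<close>

definition is_RN_deriv_comp ::
    "'x measure \<Rightarrow> 'x set \<Rightarrow> ('x \<Rightarrow> 'x) \<Rightarrow> ('x \<Rightarrow> ennreal) \<Rightarrow> bool" where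
  "is_RN_deriv_comp M D \<sigma> h \<longleftrightarrow>
     h \<in> borel_measurable M \<and>
     (\<forall>E \<in> sets M. E \<subseteq> D \<longrightarrow>
        \<sigma> ` E \<in> sets M \<and> emeasure M (\<sigma> ` E) = emeasure (density M h) E)"

definition semibranching_function_system ::
    "'x measure \<Rightarrow> 'i set \<Rightarrow> ('i \<Rightarrow> 'x set) \<Rightarrow> ('i \<Rightarrow> 'x \<Rightarrow> 'x) \<Rightarrow> bool" where
  "semibranching_function_system M I D \<sigma> \<longleftrightarrow>
     finite I \<and>
     (\<forall>i \<in> I. D i \<in> sets M \<and> \<sigma> i \<in> restrict_space M (D i) \<rightarrow>\<^sub>M M) \<and>
     emeasure M (space M - (\<Union>i \<in> I. \<sigma> i ` D i)) = 0 \<and>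
     (\<forall>i \<in> I. \<forall>j \<in> I. i \<noteq> j \<longrightarrow> emeasure M (\<sigma> i ` D i \<inter> \<sigma> j ` D j) = 0) \<and>
     (\<forall>i \<in> I. \<exists>h. is_RN_deriv_comp M (D i) (\<sigma> i) h \<and> (AE z in M. z \<in> D i \<longrightarrow> 0 < h z))"

definition coding_map ::
    "'x measure \<Rightarrow> 'i set \<Rightarrow> ('i \<Rightarrow> 'x set) \<Rightarrow> ('i \<Rightarrow> 'x \<Rightarrow> 'x) \<Rightarrow> ('x \<Rightarrow> 'x) \<Rightarrow> bool" where
  "coding_map M I D \<sigma> \<theta> \<longleftrightarrow>
     \<theta> \<in> M \<rightarrow>\<^sub>M M \<and> (\<forall>i \<in> I. \<forall>x \<in> D i. \<theta> (\<sigma> i x) = x)"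

text \<open>
  In the third clause, \<open>\<tau>\<^sub>\<lambda> \<circ> \<tau>\<^sub>\<nu> = \<tau>\<^sub>\<lambda>\<^sub>\<nu>\<close> almost everywhere is an equation between partially
  defined maps, hence includes that their domains agree up to a null set.
\<close>

definition Lambda_semibranching_function_system ::
    "('a, 'k::finite) graded_category \<Rightarrow> 'x measure \<Rightarrow> ('a \<Rightarrow> 'x set) \<Rightarrow> ('a \<Rightarrow> 'x \<Rightarrow> 'x)
      \<Rightarrow> (nat ^ 'k \<Rightarrow> 'x \<Rightarrow> 'x) \<Rightarrow> bool" where
  "Lambda_semibranching_function_system L M D \<tau> \<theta> \<longleftrightarrow>
     finite_k_graph L \<and>
     (\<forall>m. semibranching_function_system M (deg_set L m) D \<tau>
        \<and> coding_map M (deg_set L m) D \<tau> (\<theta> m)) \<and>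
     (\<forall>v \<in> vertices L. (\<forall>x \<in> D v. \<tau> v x = x) \<and> 0 < emeasure M (D v)) \<and>
     (\<forall>l n. composable L l n \<longrightarrow>
        emeasure M (\<tau> n ` D n - D l) = 0 \<and>
        (AE x in M. (x \<in> D n \<and> \<tau> n x \<in> D l \<longleftrightarrow> x \<in> D (cmp L l n))
           \<and> (x \<in> D (cmp L l n) \<longrightarrow> \<tau> l (\<tau> n x) = \<tau> (cmp L l n) x))) \<and>
     (\<forall>m n. \<forall>x \<in> space M. \<theta> m (\<theta> n x) = \<theta> (m + n) x)"

text \<open>
  The value at the point \<open>z\<close> of the derivative of \<open>\<mu> \<circ> \<sigma>\<close> with respect to \<open>\<mu>\<close>, as the limit of the
  quotients over the cylinder sets \<open>Z(z(0,(n,\<dots>,n)))\<close>, which shrink to \<open>z\<close>.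
\<close>

definition has_cylinder_deriv_at ::
    "('a, 'k::finite) graded_category \<Rightarrow> ('a, 'k) path measure
      \<Rightarrow> (('a, 'k) path \<Rightarrow> ('a, 'k) path) \<Rightarrow> ('a, 'k) path \<Rightarrow> ennreal \<Rightarrow> bool" where
  "has_cylinder_deriv_at L M \<sigma> z c \<longleftrightarrow>
     (\<lambda>n::nat. emeasure M (\<sigma> ` cylinder L (z (0, vec n))) / emeasure M (cylinder L (z (0, vec n))))
       \<longlonglongrightarrow> c"

text \<open>
  The edges \<open>f\<^sub>1, f\<^sub>2\<close> are \<open>f 1, f 2\<close>. By the factorisation property, these data determine the
  2-graph up to isomorphism.
\<close>

definition flip_2graph :: "('a, 2) graded_category \<Rightarrow> 'a \<Rightarrow> 'a \<Rightarrow> (nat \<Rightarrow> 'a) \<Rightarrow> bool" where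
  "flip_2graph L v e f \<longleftrightarrow>
     k_graph L \<and> vertices L = {v} \<and>
     deg_set L (axis 1 1) = {f 1, f 2} \<and> f 1 \<noteq> f 2 \<and>
     deg_set L (axis 2 1) = {e} \<and>
     cmp L (f 1) e = cmp L e (f 2) \<and> cmp L (f 2) e = cmp L e (f 1)"

text \<open>For \<open>as = [a\<^sub>1, \<dots>, a\<^sub>n]\<close>, the morphism \<open>e f\<^bsub>a\<^sub>1+1\<^esub> \<cdots> e f\<^bsub>a\<^sub>n+1\<^esub>\<close>.\<close>

definition ef_word ::
    "('a, 2) graded_category \<Rightarrow> 'a \<Rightarrow> 'a \<Rightarrow> (nat \<Rightarrow> 'a) \<Rightarrow> nat list \<Rightarrow> 'a" where
  "ef_word L v e f as = foldr (\<lambda>a l. cmp L (cmp L e (f (a + 1))) l) as v"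

definition T_matrix :: "real \<Rightarrow> nat \<Rightarrow> nat \<Rightarrow> real" where
  "T_matrix x i j = [[x, 1 - x], [1 - x, x]] ! i ! j"

definition markov_weight :: "(nat \<Rightarrow> real) \<Rightarrow> (nat \<Rightarrow> nat \<Rightarrow> real) \<Rightarrow> nat list \<Rightarrow> real" where
  "markov_weight p T as = p (as ! 0) * (\<Prod>i < length as - 1. T (as ! i) (as ! (i + 1)))"

definition is_mu ::
    "('a, 2) graded_category \<Rightarrow> 'a \<Rightarrow> 'a \<Rightarrow> (nat \<Rightarrow> 'a) \<Rightarrow> real \<Rightarrow> ('a, 2) path measure \<Rightarrow> bool" where
  "is_mu L v e f x M \<longleftrightarrow>
     sets M = sets (path_borel L) \<and>
     (\<forall>as. as \<noteq> [] \<and> set as \<subseteq> {0, 1} \<longrightarrow>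
        emeasure M (cylinder L (ef_word L v e f as))
          = ennreal (markov_weight (\<lambda>i. 1) (T_matrix x) as))"

end

theory Submission
  imports Defs
begin

text \<open>
  Every infinite path of the flip 2-graph is \<open>e f\<^bsub>a\<^sub>1+1\<^esub> e f\<^bsub>a\<^sub>2+1\<^esub> \<cdots>\<close> for a
  unique sequence of bits \<open>a\<^sub>1, a\<^sub>2, \<dots>\<close>. The factorisation rules say that moving \<open>e\<close> past an edge
  \<open>f\<^sub>i\<close> interchanges \<open>f\<^sub>1\<close> and \<open>f\<^sub>2\<close>. Hence, in terms of bits, prefixing by \<open>e\<close> complements the
  sequence, and prefixing by \<open>f\<^bsub>b+1\<^esub>\<close> complements it and puts \<open>1 - b\<close> in front (\<open>prefix_e_word\<close>,
  \<open>prefix_f_word\<close>). The matrix \<open>T\<close> is invariant under complementing both indices. So prefixing by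
  \<open>e\<close> preserves the measure of each cylinder of a word, and prefixing by \<open>f\<^bsub>b+1\<^esub>\<close> multiplies it by
  \<open>T b a\<^sub>1\<close>. These cylinders are an intersection-stable generator of the Borel sets, so the constant
  1 and the function \<open>T b a\<^sub>1\<close> are the derivatives of the two kinds of prefixing maps
  (\<open>derivative_from_words\<close>, \<open>edge_derivatives\<close>). Both are positive because \<open>0 < x < 1\<close>, and they are
  locally constant, so the difference quotients over shrinking cylinders are eventually constant.

  An arbitrary morphism is a product of edges, and prefixing by a product is the composition of the
  prefixing maps; by the chain rule \<open>is_RN_deriv_comp_compose\<close>, all prefixing maps have positive
  derivatives. The remaining conditions on a \<open>\<Lambda>\<close>-semibranching function system hold everywhere, and
  most of them in any k-graph. Prefixing by \<open>\<lambda>\<close> is a bijection from the paths that start at the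
  source of \<open>\<lambda>\<close> to the cylinder of \<open>\<lambda>\<close>, with the coding map as its inverse, and the cylinders of
  the morphisms of a given degree partition the path space. The existence of prefixed paths
  (\<open>prefixed_path_ex\<close>) rests on unique factorisation alone.
\<close>

section \<open>Factorisation of morphisms in a k-graph\<close>

lemma vec_nat_le_add: "p \<le> p + q" "q \<le> p + q" for p q :: "nat ^ 'k::finite"
  by (auto simp: less_eq_vec_def)

lemma vec_nat_add_diff: "p \<le> q \<Longrightarrow> p + (q - p) = q" for p q :: "nat ^ 'k::finite"
  by (auto simp: less_eq_vec_def vec_eq_iff)

lemma vec_nat_diff_add: "p \<le> q \<Longrightarrow> q \<le> r \<Longrightarrow> (q - p) + (r - q) = r - p" for p q r :: "nat ^ 'k::finite"
  by (auto simp: less_eq_vec_def vec_eq_iff)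

lemma vec_nat_add_diff_cancel: "p + q - p = q" "q + p - p = q" "p - p = 0" "p - 0 = p"
    "(p + r) - (q + r) = p - q" for p q r :: "nat ^ 'k::finite"
  by (auto simp: vec_eq_iff)

lemma vec_nat_zero_le: "0 \<le> p" for p :: "nat ^ 'k::finite"
  by (auto simp: less_eq_vec_def)

lemma vec_nat_add_right_mono: "p + m \<le> q + m \<longleftrightarrow> p \<le> q" for p q m :: "nat ^ 'k::finite"
  by (auto simp: less_eq_vec_def)

lemmas vec_nat = vec_nat_le_add vec_nat_add_diff vec_nat_diff_add vec_nat_add_diff_cancel
  vec_nat_zero_le vec_nat_add_right_mono

locale kgraph =
  fixes L :: "('a, 'k::finite) graded_category"
  assumes k_graph: "k_graph L"
begin

abbreviation comp (infixl "\<cdot>" 70) where "a \<cdot> b \<equiv> cmp L a b"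
abbreviation X where "X \<equiv> inf_paths L"
abbreviation Z where "Z \<equiv> cylinder L"
abbreviation pre where "pre \<equiv> std_prefixing L"

lemma cat: "small_category L" and degf: "degree_functor L" and countable_mor: "countable (mor L)"
  using k_graph by (auto simp: k_graph_def)

lemma mor_ends [simp]:
  assumes "a \<in> mor L"
  shows "rng L a \<in> mor L" "src L a \<in> mor L" "rng L (rng L a) = rng L a" "src L (rng L a) = rng L a"
    "rng L (src L a) = src L a" "src L (src L a) = src L a" "rng L a \<cdot> a = a" "a \<cdot> src L a = a"
    "deg L (rng L a) = 0" "deg L (src L a) = 0"
  using cat degf assms by (auto simp: small_category_def degree_functor_def)

lemma composableD:
  assumes "composable L a b"
  shows "a \<in> mor L" "b \<in> mor L" "src L a = rng L b"
  using assms by (auto simp: composable_def)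

lemma comp_simps [simp]:
  assumes "composable L a b"
  shows "a \<cdot> b \<in> mor L" "rng L (a \<cdot> b) = rng L a" "src L (a \<cdot> b) = src L b"
    "deg L (a \<cdot> b) = deg L a + deg L b"
  using assms cat[unfolded small_category_def, THEN conjunct2, THEN conjunct1]
    degf[unfolded degree_functor_def] by blast+

lemma comp_assoc: "composable L a b \<Longrightarrow> composable L b c \<Longrightarrow> a \<cdot> b \<cdot> c = a \<cdot> (b \<cdot> c)"
  using cat by (auto simp: small_category_def)

lemma composable_assoc:
  "composable L a b \<Longrightarrow> composable L b c \<Longrightarrow> composable L (a \<cdot> b) c \<and> composable L a (b \<cdot> c)"
  by (auto simp: composable_def)

lemma factor_ex1:
  assumes "l \<in> mor L" "deg L l = m + n"
  shows "\<exists>!(a, b). composable L a b \<and> l = a \<cdot> b \<and> deg L a = m \<and> deg L b = n"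
  using k_graph assms by (auto simp: k_graph_def)

lemma factorE:
  assumes "l \<in> mor L" "deg L l = m + n"
  obtains a b where "composable L a b" "l = a \<cdot> b" "deg L a = m" "deg L b = n"
  using factor_ex1[OF assms] by (auto dest!: ex1_implies_ex)

lemma factor_unique:
  assumes "composable L a b" "composable L c d" "a \<cdot> b = c \<cdot> d" "deg L a = deg L c"
  shows "a = c \<and> b = d"
proof -
  have *: "deg L (a \<cdot> b) = deg L a + deg L b"
    using assms(1) by simp
  have "deg L a + deg L b = deg L c + deg L d"
    using comp_simps(4)[OF assms(1)] comp_simps(4)[OF assms(2)] assms(3) by metis
  then have d: "deg L b = deg L d"
    unfolding assms(4) by (rule add_left_imp_eq)
  have "a \<cdot> b \<in> mor L"
    using assms(1) by simp
  from factor_ex1[OF this *] obtain p where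
    "\<And>q. (case q of (x, y) \<Rightarrow> composable L x y \<and> a \<cdot> b = x \<cdot> y \<and> deg L x = deg L a \<and> deg L y = deg L b)
      \<Longrightarrow> q = p"
    by (auto elim!: ex1E)
  from this[of "(a, b)"] this[of "(c, d)"] show ?thesis
    using assms d by auto
qed

text \<open>
  The factor of \<open>l\<close> between the degrees \<open>p\<close> and \<open>q\<close>, meaningful for
  \<open>p \<le> q \<le> deg L l\<close>. Infinite paths are handled through it: all values of a path are segments
  of its initial segments (see \<open>path_seg\<close>).
\<close>

definition seg :: "'a \<Rightarrow> nat ^ 'k \<Rightarrow> nat ^ 'k \<Rightarrow> 'a" where
  "seg l p q = (THE b. \<exists>a c. composable L a b \<and> composable L b c \<and> l = a \<cdot> b \<cdot> c
      \<and> deg L a = p \<and> deg L b = q - p)"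

lemma seg_eqI:
  assumes "composable L a b" "composable L b c"
  shows "seg (a \<cdot> b \<cdot> c) (deg L a) (deg L a + deg L b) = b"
  unfolding seg_def
proof (rule the_equality, goal_cases)
  case 1
  then show ?case
    using assms by (auto simp: vec_nat)
next
  case (2 b')
  then obtain a' c' where *: "composable L a' b'" "composable L b' c'" "a \<cdot> b \<cdot> c = a' \<cdot> b' \<cdot> c'"
    "deg L a' = deg L a" "deg L b' = deg L b"
    by (auto simp: vec_nat)
  have "a \<cdot> b = a' \<cdot> b' \<and> c = c'"
    by (rule factor_unique) (use * assms in \<open>auto simp: composable_assoc\<close>)
  then show ?case
    using factor_unique[of a b a' b'] * assms by auto
qed

lemma threeE:
  assumes "l \<in> mor L" "p \<le> q" "q \<le> deg L l"
  obtains a b c where "composable L a b" "composable L b c" "l = a \<cdot> b \<cdot> c" "deg L a = p"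
    "deg L b = q - p" "deg L c = deg L l - q" "seg l p q = b"
proof -
  obtain d c where 1: "composable L d c" "l = d \<cdot> c" "deg L d = q" "deg L c = deg L l - q"
    using factorE[OF assms(1), of q "deg L l - q"] assms by (auto simp: vec_nat)
  obtain a b where 2: "composable L a b" "d = a \<cdot> b" "deg L a = p" "deg L b = q - p"
    using factorE[of d p "q - p"] 1 assms by (auto simp: vec_nat composable_def)
  have 3: "composable L b c"
    using 1 2 by (auto simp: composable_def)
  show thesis
    using that[OF 2(1) 3, of] 1 2 seg_eqI[OF 2(1) 3] assms by (auto simp: vec_nat)
qed

lemma seg_mor:
  assumes "l \<in> mor L" "p \<le> q" "q \<le> deg L l"
  shows "seg l p q \<in> mor L" "deg L (seg l p q) = q - p"
  by (rule threeE[OF assms]; auto simp: composable_def)+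

lemma seg_comp_right:
  assumes "composable L l m" "p \<le> q" "q \<le> deg L l"
  shows "seg (l \<cdot> m) p q = seg l p q"
proof -
  obtain a b c where 1: "composable L a b" "composable L b c" "l = a \<cdot> b \<cdot> c" "deg L a = p"
    "deg L b = q - p" "seg l p q = b"
    using threeE[of l p q] assms composableD(1) by metis
  have 2: "composable L c m" "composable L b (c \<cdot> m)" "l \<cdot> m = a \<cdot> b \<cdot> (c \<cdot> m)"
    using 1 assms(1) comp_assoc[of "a \<cdot> b" c m] by (auto simp: composable_def)
  show ?thesis
    using seg_eqI[OF 1(1) 2(2)] 1 2 assms by (auto simp: vec_nat)
qed

lemma seg_comp_left:
  assumes "composable L l m" "p \<le> q" "q \<le> deg L m"
  shows "seg (l \<cdot> m) (p + deg L l) (q + deg L l) = seg m p q"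
proof -
  obtain a b c where 1: "composable L a b" "composable L b c" "m = a \<cdot> b \<cdot> c" "deg L a = p"
    "deg L b = q - p" "seg m p q = b"
    using threeE[of m p q] assms composableD(2) by metis
  have 2: "composable L l a" "composable L (l \<cdot> a) b" "l \<cdot> m = l \<cdot> a \<cdot> b \<cdot> c"
    using 1 assms(1) comp_assoc[of l "a \<cdot> b" c] comp_assoc[of l a b] by (auto simp: composable_def)
  have "deg L l + p + (q - p) = q + deg L l"
    using assms(2) by (metis vec_nat_add_diff add.assoc add.commute)
  then show ?thesis
    using seg_eqI[OF 2(2) 1(2)] 1 2 assms by (auto simp: vec_nat add.commute)
qed

lemma seg_initial: "composable L a b \<Longrightarrow> seg (a \<cdot> b) 0 (deg L a) = a"
  using seg_eqI[of "rng L a" a b] by (auto simp: composable_def)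

lemma seg_ends:
  assumes "l \<in> mor L" "p \<le> q" "q \<le> deg L l"
  shows "seg l p p = rng L (seg l p q)" "seg l q q = src L (seg l p q)"
proof -
  obtain a b c where 1: "composable L a b" "composable L b c" "l = a \<cdot> b \<cdot> c" "deg L a = p"
    "deg L b = q - p" "seg l p q = b"
    using threeE[OF assms] by metis
  show "seg l p p = rng L (seg l p q)"
    using seg_eqI[of a "rng L b" "b \<cdot> c"] 1 comp_assoc[of a b c] mor_ends(8)[of a]
    by (auto simp: composable_def)
  show "seg l q q = src L (seg l p q)"
    using seg_eqI[of "a \<cdot> b" "rng L c" c] 1 assms mor_ends(8)[of "a \<cdot> b"] comp_simps[OF 1(1)]
    by (auto simp: composable_def vec_nat)
qed

lemma seg_comp:
  assumes "l \<in> mor L" "p \<le> q" "q \<le> r" "r \<le> deg L l"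
  shows "composable L (seg l p q) (seg l q r)" "seg l p r = seg l p q \<cdot> seg l q r"
proof -
  obtain d b' c where 1: "composable L d b'" "composable L b' c" "l = d \<cdot> b' \<cdot> c" "deg L d = q"
    "deg L b' = r - q" "seg l q r = b'"
    using threeE[of l q r] assms by metis
  obtain a b where 2: "composable L a b" "d = a \<cdot> b" "deg L a = p" "deg L b = q - p"
    using factorE[of d p "q - p"] 1 assms by (auto simp: vec_nat composable_def)
  have b: "seg l p q = b"
    using seg_eqI[of a b "b' \<cdot> c"] 1 2 comp_assoc[of "a \<cdot> b" b' c] assms
    by (auto simp: composable_def vec_nat)
  have "seg l p r = b \<cdot> b'"
    using seg_eqI[of a "b \<cdot> b'" c] 1 2 comp_assoc[of a b b'] assms
    by (auto simp: composable_def vec_nat)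
  then show "seg l p r = seg l p q \<cdot> seg l q r" "composable L (seg l p q) (seg l q r)"
    using 1 2 b by (auto simp: composable_def)
qed

section \<open>Infinite paths, prefixing and coding\<close>

lemma Omega_simps [simp]:
  "(p, q) \<in> mor Omega \<longleftrightarrow> p \<le> q" "rng Omega (p, q) = (p, p)" "src Omega (p, q) = (q, q)"
  "cmp Omega (p, q) (p', q') = (p, q')" "deg Omega (p, q) = q - p"
  "composable Omega (p, q) (p', q') \<longleftrightarrow> p \<le> q \<and> p' \<le> q' \<and> q = p'"
  by (auto simp: Omega_def composable_def)

lemma path_simps:
  assumes "x \<in> X" "p \<le> q"
  shows "x (p, q) \<in> mor L" "deg L (x (p, q)) = q - p" "rng L (x (p, q)) = x (p, p)"
    "src L (x (p, q)) = x (q, q)"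
proof -
  have "x (p, q) \<in> mor L \<and> deg L (x (p, q)) = deg Omega (p, q)
      \<and> x (rng Omega (p, q)) = rng L (x (p, q)) \<and> x (src Omega (p, q)) = src L (x (p, q))"
    using assms(1) iffD2[OF Omega_simps(1) assms(2)]
    unfolding inf_paths_def degree_preserving_functor_def by blast
  then show "x (p, q) \<in> mor L" "deg L (x (p, q)) = q - p" "rng L (x (p, q)) = x (p, p)"
    "src L (x (p, q)) = x (q, q)"
    by simp_all
qed

lemma path_split:
  assumes "x \<in> X" "p \<le> q" "q \<le> r"
  shows "composable L (x (p, q)) (x (q, r))" "x (p, r) = x (p, q) \<cdot> x (q, r)"
proof -
  show "composable L (x (p, q)) (x (q, r))"
    using assms by (auto simp: composable_def path_simps)
  have "composable Omega (p, q) (q, r)"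
    using assms by auto
  then have "x (cmp Omega (p, q) (q, r)) = x (p, q) \<cdot> x (q, r)"
    using assms(1) unfolding inf_paths_def degree_preserving_functor_def by blast
  then show "x (p, r) = x (p, q) \<cdot> x (q, r)"
    by simp
qed

lemma path_seg:
  assumes "x \<in> X" "p \<le> q" "q \<le> r"
  shows "seg (x (0, r)) p q = x (p, q)"
proof -
  have "x (0, r) = x (0, p) \<cdot> x (p, q) \<cdot> x (q, r)"
    using path_split[of x 0 p q] path_split[of x 0 q r] assms
    by (auto simp: vec_nat)
  then show ?thesis
    using seg_eqI[of "x (0, p)" "x (p, q)" "x (q, r)"] path_split[of x 0 p q] path_split[of x p q r] assms
    by (auto simp: vec_nat path_simps)
qed

text \<open>
  The initial segments of degree \<open>q + m\<close> are cofinal among all initial segments, so they determine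
  the path. The offset \<open>m\<close> is there for paths that begin with a prescribed morphism of degree \<open>m\<close>.
\<close>

lemma path_eqI:
  assumes "x \<in> X" "y \<in> X" "\<And>q. x (0, q + m) = y (0, q + m)"
  shows "x = y"
proof (rule extensionalityI[where A = "mor Omega"])
  show "x \<in> extensional (mor Omega)" "y \<in> extensional (mor Omega)"
    using assms by (auto simp: inf_paths_def)
  fix w :: "(nat ^ 'k) \<times> (nat ^ 'k)"
  assume "w \<in> mor Omega"
  then obtain p q where w: "w = (p, q)" "p \<le> q"
    by (cases w) auto
  show "x w = y w"
    using path_seg[of x p q "q + m"] path_seg[of y p q "q + m"] assms w by (simp add: vec_nat)
qed

lemma cylinder_sub: "Z l \<subseteq> X"
  by (auto simp: cylinder_def)

lemma std_domain_iff: "l \<in> mor L \<Longrightarrow> x \<in> std_domain L l \<longleftrightarrow> x \<in> X \<and> x (0, 0) = src L l"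
  by (auto simp: std_domain_def cylinder_def)

lemma coding_apply: "p \<le> q \<Longrightarrow> std_coding m x (p, q) = x (p + m, q + m)"
  by (auto simp: std_coding_def)

lemma coding_path:
  assumes "x \<in> X"
  shows "std_coding m x \<in> X"
proof -
  have "degree_preserving_functor Omega L (std_coding m x)"
    unfolding degree_preserving_functor_def
    by (auto simp: coding_apply path_simps path_split assms vec_nat)
  then show ?thesis
    by (auto simp: inf_paths_def std_coding_def)
qed

lemma coding_coding: "std_coding m (std_coding n x) = std_coding (m + n) x"
  by (auto simp: std_coding_def vec_nat fun_eq_iff add.assoc restrict_def)

lemma path_comp_composable:
  assumes "l \<in> mor L" "x \<in> std_domain L l"
  shows "composable L l (x (0, q))"
  using assms by (auto simp: composable_def path_simps std_domain_iff vec_nat)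

text \<open>
  The path \<open>l x\<close> has to be defined on all pairs, also on those whose end does not lie beyond the
  degree of \<open>l\<close>. Its value at \<open>(p, q)\<close> is read off from the finite path \<open>l \<cdot> x (0, q)\<close>, which is
  long enough. A longer finite path \<open>l \<cdot> x (0, r)\<close> gives the same value; this independence makes
  the functor laws instances of the corresponding laws for segments of one finite path.
\<close>

lemma prefixed_path_ex:
  assumes l: "l \<in> mor L" and x: "x \<in> std_domain L l"
  shows "\<exists>y \<in> Z l. std_coding (deg L l) y = x"
proof -
  define w where "w q = l \<cdot> x (0, q)" for q
  define y where "y = restrict (\<lambda>(p, q). seg (w q) p q) (mor Omega)"
  have xX: "x \<in> X"
    using x l by (simp add: std_domain_iff)
  have w: "w q \<in> mor L" "deg L (w q) = deg L l + q" for q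
    using path_comp_composable[OF l x, of q] xX by (auto simp: w_def path_simps vec_nat)
  have wle: "p \<le> q \<Longrightarrow> p \<le> deg L (w q)" for p q
    by (auto simp: w less_eq_vec_def trans_le_add2)
  have y: "y (p, q) = seg (w r) p q" if "p \<le> q" "q \<le> r" for p q r
  proof -
    have c: "composable L (x (0, q)) (x (q, r))"
      using that xX by (auto intro: path_split(1) simp: vec_nat)
    have "w r = w q \<cdot> x (q, r)" "composable L (w q) (x (q, r))"
      using path_comp_composable[OF l x, of q] c path_split(2)[OF xX, of 0 q r] that
      by (auto simp: w_def comp_assoc vec_nat composable_def)
    then show ?thesis
      using seg_comp_right[of "w q" "x (q, r)" p q] that by (auto simp: y_def wle)
  qed
  have "degree_preserving_functor Omega L y"
    unfolding degree_preserving_functor_def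
  proof (intro conjI ballI allI impI)
    fix a :: "(nat ^ 'k) \<times> (nat ^ 'k)"
    assume "a \<in> mor Omega"
    then obtain p q where a: "a = (p, q)" "p \<le> q"
      by (cases a) auto
    show "y a \<in> mor L" "deg L (y a) = deg Omega a" "y (rng Omega a) = rng L (y a)"
      "y (src Omega a) = src L (y a)"
      using a y[of p q q] y[of p p q] y[of q q q] seg_mor[of "w q" p q] seg_ends[of "w q" p q]
      by (auto simp: w(1) wle)
  next
    fix a b :: "(nat ^ 'k) \<times> (nat ^ 'k)"
    assume "composable Omega a b"
    then obtain p q r where a: "a = (p, q)" "b = (q, r)" "p \<le> q" "q \<le> r"
      by (cases a, cases b) auto
    show "y (cmp Omega a b) = y a \<cdot> y b"
      using a y[of p q r] y[of p r r] y[of q r r] seg_comp[of "w r" p q r]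
      by (auto simp: w(1) wle)
  qed
  then have yX: "y \<in> X"
    by (auto simp: inf_paths_def y_def)
  have "y (0, deg L l) = l"
    using seg_initial[OF path_comp_composable[OF l x], of "deg L l"] y[of 0 "deg L l" "deg L l"]
    by (simp add: w_def vec_nat)
  then have yZ: "y \<in> Z l"
    using yX by (simp add: cylinder_def)
  have "std_coding (deg L l) y = x"
  proof (rule path_eqI[where m = 0])
    show "std_coding (deg L l) y \<in> X" "x \<in> X"
      using coding_path yX xX by auto
    fix q
    have "y (deg L l, q + deg L l) = seg (w (q + deg L l)) (0 + deg L l) (q + deg L l)"
      using y[of "deg L l" "q + deg L l" "q + deg L l"] by (simp add: vec_nat)
    also have "\<dots> = seg (x (0, q + deg L l)) 0 q"
      unfolding w_def by (rule seg_comp_left[OF path_comp_composable[OF l x]])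
        (use xX in \<open>auto simp: vec_nat path_simps\<close>)
    also have "\<dots> = x (0, q)"
      using path_seg[OF xX] by (simp add: vec_nat)
    finally show "std_coding (deg L l) y (0, q + 0) = x (0, q + 0)"
      by (simp add: coding_apply vec_nat)
  qed
  then show ?thesis
    using yZ by blast
qed

lemma cylinder_path_from:
  assumes "l \<in> mor L" "y \<in> Z l"
  shows "std_coding (deg L l) y \<in> std_domain L l"
    and "y (0, q + deg L l) = l \<cdot> std_coding (deg L l) y (0, q)"
  using assms path_split(2)[of y 0 "deg L l" "q + deg L l"] path_simps(4)[of y 0 "deg L l"]
  by (auto simp: cylinder_def std_domain_iff coding_path coding_apply vec_nat)

lemma prefixed_path_unique:
  assumes "l \<in> mor L" "y \<in> Z l" "y' \<in> Z l" "std_coding (deg L l) y = std_coding (deg L l) y'"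
  shows "y = y'"
proof (rule path_eqI[where m = "deg L l"])
  show "y (0, q + deg L l) = y' (0, q + deg L l)" for q
    using cylinder_path_from(2)[OF assms(1,2)] cylinder_path_from(2)[OF assms(1,3)] assms(4) by simp
qed (use assms cylinder_sub in auto)

lemma prefixing:
  assumes "l \<in> mor L" "x \<in> std_domain L l"
  shows "pre l x \<in> Z l" "std_coding (deg L l) (pre l x) = x"
proof -
  have "\<exists>!y. y \<in> Z l \<and> std_coding (deg L l) y = x"
    using prefixed_path_ex[OF assms] prefixed_path_unique[OF assms(1)] by blast
  from theI'[OF this] show "pre l x \<in> Z l" "std_coding (deg L l) (pre l x) = x"
    by (simp_all add: std_prefixing_def)
qed

lemma prefixing_eqI:
  assumes "l \<in> mor L" "y \<in> Z l" "std_coding (deg L l) y = x"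
  shows "pre l x = y"
  using assms cylinder_path_from(1) prefixed_path_unique prefixing by metis

lemma prefixing_path: "l \<in> mor L \<Longrightarrow> x \<in> std_domain L l \<Longrightarrow> pre l x \<in> X"
  using prefixing(1) cylinder_sub by blast

lemma prefixing_initial:
  assumes "l \<in> mor L" "x \<in> std_domain L l"
  shows "pre l x (0, q) = seg (l \<cdot> x (0, q)) 0 q"
  using path_seg[OF prefixing_path[OF assms], of 0 q "q + deg L l"]
    cylinder_path_from(2)[OF assms(1) prefixing(1)[OF assms], of q] prefixing(2)[OF assms]
  by (simp add: vec_nat)

text \<open>
  Prefixing and coding are mutually inverse between \<open>std_domain L l\<close> and \<open>Z l\<close>; hence images under
  prefixing are preimages under coding, which is what makes them measurable.
\<close>

lemma prefixing_image:
  assumes "l \<in> mor L" "E \<subseteq> std_domain L l"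
  shows "pre l ` E = {y \<in> Z l. std_coding (deg L l) y \<in> E}"
proof (intro subset_antisym subsetI)
  fix y assume "y \<in> pre l ` E"
  then show "y \<in> {y \<in> Z l. std_coding (deg L l) y \<in> E}"
    using assms prefixing[OF assms(1)] by auto
next
  fix y assume "y \<in> {y \<in> Z l. std_coding (deg L l) y \<in> E}"
  then show "y \<in> pre l ` E"
    using prefixing_eqI[OF assms(1), of y] by (metis (mono_tags, lifting) image_eqI mem_Collect_eq)
qed

lemma prefixing_range: "l \<in> mor L \<Longrightarrow> pre l ` std_domain L l = Z l"
  using prefixing_image[of l "std_domain L l"] cylinder_path_from(1)[of l] by auto

text \<open>
  By unique factorisation, beginning with \<open>l \<cdot> n\<close> is the same as beginning with \<open>l\<close> and continuing
  with \<open>n\<close>.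
\<close>

lemma cylinder_comp_iff:
  assumes "composable L l n"
  shows "y \<in> Z (l \<cdot> n) \<longleftrightarrow> y \<in> Z l \<and> std_coding (deg L l) y \<in> Z n"
proof -
  let ?d = "deg L l" and ?d' = "deg L l + deg L n"
  show ?thesis
  proof (cases "y \<in> X")
    case True
    have s: "y (0, ?d') = y (0, ?d) \<cdot> y (?d, ?d')" "composable L (y (0, ?d)) (y (?d, ?d'))"
      using path_split[OF True, of 0 ?d ?d'] by (auto simp: vec_nat)
    have "y (0, ?d') = l \<cdot> n \<longleftrightarrow> y (0, ?d) = l \<and> y (?d, ?d') = n"
      using factor_unique[OF s(2) assms] True s(1) by (auto simp: path_simps vec_nat)
    then show ?thesis
      using assms True by (auto simp: cylinder_def coding_path coding_apply vec_nat add.commute)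
  qed (auto simp: cylinder_def)
qed

lemma cylinder_sub_std_domain:
  assumes "composable L l n"
  shows "Z n \<subseteq> std_domain L l"
proof
  fix x assume "x \<in> Z n"
  then have "x \<in> X" "x (0, deg L n) = n"
    by (auto simp: cylinder_def)
  then have "x \<in> X" "x (0, 0) = rng L n"
    using path_simps(3)[of x 0 "deg L n"] by (auto simp: vec_nat)
  then show "x \<in> std_domain L l"
    using assms by (simp add: composable_def std_domain_iff)
qed

lemma prefixing_cylinder:
  assumes "composable L l n"
  shows "pre l ` Z n = Z (l \<cdot> n)"
  using prefixing_image[of l "Z n"] cylinder_comp_iff[OF assms] assms
    cylinder_sub_std_domain[OF assms] by (auto simp: composable_def)

lemma prefixing_comp:
  assumes "composable L l n" "x \<in> std_domain L n"
  shows "pre n x \<in> std_domain L l" "pre l (pre n x) = pre (l \<cdot> n) x"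
proof -
  have m: "l \<in> mor L" "n \<in> mor L"
    using assms by (auto simp: composable_def)
  have n: "pre n x \<in> Z n" "std_coding (deg L n) (pre n x) = x"
    using prefixing[OF m(2) assms(2)] by auto
  show *: "pre n x \<in> std_domain L l"
    using n(1) cylinder_sub_std_domain[OF assms(1)] by auto
  have "pre l (pre n x) \<in> Z (l \<cdot> n)"
    using cylinder_comp_iff[OF assms(1)] prefixing[OF m(1) *] n by auto
  moreover have "std_coding (deg L (l \<cdot> n)) (pre l (pre n x)) = x"
    using prefixing(2)[OF m(1) *] n(2) assms(1)
      coding_coding[of "deg L n" "deg L l" "pre l (pre n x)"]
    by (simp add: add.commute)
  ultimately show "pre l (pre n x) = pre (l \<cdot> n) x"
    using prefixing_eqI[of "l \<cdot> n"] assms(1) by simp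
qed

lemma coding_zero: "x \<in> X \<Longrightarrow> std_coding 0 x = x"
  by (auto simp: std_coding_def inf_paths_def extensional_restrict cong: restrict_cong)

lemma prefixing_vertex:
  assumes "l \<in> mor L" "deg L l = 0" "x \<in> std_domain L l"
  shows "pre l x = x"
  using prefixing[OF assms(1,3)] coding_zero prefixing_path[OF assms(1,3)] assms(2) by simp

lemma std_domain_comp: "composable L l n \<Longrightarrow> std_domain L (l \<cdot> n) = std_domain L n"
  by (simp add: std_domain_def)

lemma cylinder_mem_initial: "x \<in> X \<Longrightarrow> x \<in> Z (x (0, q))"
  by (simp add: cylinder_def path_simps vec_nat)

section \<open>Measurability\<close>

text \<open>
  There are only countably many finite intersections of subbasic sets, so that every open set is a
  countable union of such intersections.
\<close>

lemma countable_subbase_sigma_sets: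
  assumes "countable S" "generate_topology_on S U"
  shows "U \<in> sigma_sets (\<Union>S) S"
proof -
  interpret sigma_algebra "\<Union>S" "sigma_sets (\<Union>S) S"
    by (rule sigma_algebra_sigma_sets) auto
  let ?F = "{F. finite F \<and> F \<subseteq> S}"
  obtain V where V: "V \<subseteq> Collect (finite' intersection_of (\<lambda>x. x \<in> S))" "U = \<Union>V"
    using assms(2) unfolding generate_topology_on_eq union_of_def arbitrary_def by auto
  have V': "\<exists>F. F \<noteq> {} \<and> F \<in> ?F \<and> W = \<Inter>F" if "W \<in> V" for W
    using that V(1) unfolding intersection_of_def by auto
  have "W \<in> sigma_sets (\<Union>S) S" if W: "W \<in> V" for W
  proof -
    obtain F where "F \<noteq> {}" "finite F" "F \<subseteq> S" "W = \<Inter>F"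
      using V'[OF W] by blast
    then show ?thesis
      using finite_INT[of F "\<lambda>x. x"] sigma_sets.Basic by (simp add: subset_iff)
  qed
  moreover have "countable V"
    by (rule countable_subset[of _ "Inter ` ?F"])
      (use V' countable_Collect_finite_subset[OF assms(1)] in auto)
  ultimately show ?thesis
    using countable_UN'[of V "\<lambda>x. x"] V(2) by (simp add: subset_iff)
qed

lemma union_cylinders: "\<Union>(Z ` mor L) = X"
proof
  show "X \<subseteq> \<Union>(Z ` mor L)"
    using cylinder_mem_initial[of _ 0] path_simps(1)[of _ 0 0] by auto
qed (use cylinder_sub in auto)

lemma sets_path_borel: "sets (path_borel L) = sigma_sets X (Z ` mor L)"
proof -
  have "U \<subseteq> X" if "openin (path_topology L) U" for U
    using openin_subset[OF that] union_cylinders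
    unfolding path_topology_def topology_generated_by_topspace by simp
  then have 1: "sets (path_borel L) = sigma_sets X {U. openin (path_topology L) U}"
    unfolding path_borel_def by (subst sets_measure_of) auto
  have "countable (Z ` mor L)"
    using countable_mor by simp
  then have "openin (path_topology L) U \<Longrightarrow> U \<in> sigma_sets X (Z ` mor L)" for U
    using countable_subbase_sigma_sets[of "Z ` mor L" U] union_cylinders
    unfolding path_topology_def openin_topology_generated_by_iff by simp
  moreover have "U \<in> Z ` mor L \<Longrightarrow> openin (path_topology L) U" for U
    unfolding path_topology_def by (rule topology_generated_by_Basis)
  ultimately show ?thesis
    unfolding 1 by (intro sigma_sets_eqI) auto
qed

lemma space_path_borel: "space (path_borel L) = X"
  by (simp add: path_borel_def space_measure_of_conv)

end

locale kgraph_measure = kgraph L for L :: "('a, 'k::finite) graded_category" +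
  fixes M :: "('a, 'k) path measure"
  assumes sets_M: "sets M = sets (path_borel L)"
begin

lemma space_M: "space M = X"
  using sets_eq_imp_space_eq[OF sets_M] space_path_borel by simp

lemma cylinder_measurable: "l \<in> mor L \<Longrightarrow> Z l \<in> sets M"
  unfolding sets_M sets_path_borel by auto

text \<open>
  Any condition on one initial segment is measurable, being a countable union of cylinders. Both
  coding and prefixing are measurable because they express initial segments of the image through
  initial segments of the argument.
\<close>

lemma initial_segment_measurable: "{x \<in> X. P (x (0, q))} \<in> sets M"
proof -
  have "{x \<in> X. P (x (0, q))} = (\<Union>l \<in> {l \<in> mor L. deg L l = q \<and> P l}. Z l)"
    using cylinder_mem_initial[of _ q] path_simps(1,2)[of _ 0 q] by (auto simp: cylinder_def vec_nat)
  also have "\<dots> \<in> sets M"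
    by (rule sets.countable_UN') (use cylinder_measurable countable_mor in \<open>auto intro: countable_subset\<close>)
  finally show ?thesis .
qed

lemma measurable_into_M:
  assumes "\<And>x. x \<in> space N \<Longrightarrow> g x \<in> X"
    and "\<And>l. l \<in> mor L \<Longrightarrow> {x \<in> space N. g x (0, deg L l) = l} \<in> sets N"
  shows "g \<in> N \<rightarrow>\<^sub>M M"
proof (rule measurable_sigma_sets[where \<Omega> = X and A = "Z ` mor L"])
  show "sets M = sigma_sets X (Z ` mor L)"
    using sets_M sets_path_borel by simp
  show "Z ` mor L \<subseteq> Pow X"
    using cylinder_sub by auto
  show "g \<in> space N \<rightarrow> X"
    using assms by auto
  fix U assume "U \<in> Z ` mor L"
  then obtain l where l: "l \<in> mor L" "U = Z l"
    by auto
  then have "g -` U \<inter> space N = {x \<in> space N. g x (0, deg L l) = l}"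
    using assms(1) by (auto simp: cylinder_def)
  then show "g -` U \<inter> space N \<in> sets N"
    using assms(2) l by simp
qed

lemma coding_measurable: "std_coding m \<in> M \<rightarrow>\<^sub>M M"
proof (rule measurable_into_M)
  fix l
  have "{x \<in> space M. std_coding m x (0, deg L l) = l}
    = {x \<in> X. seg (x (0, deg L l + m)) m (deg L l + m) = l}"
    using path_seg[of _ m "deg L l + m" "deg L l + m"] by (auto simp: space_M coding_apply vec_nat)
  then show "{x \<in> space M. std_coding m x (0, deg L l) = l} \<in> sets M"
    using initial_segment_measurable[of "\<lambda>w. seg w m (deg L l + m) = l"] by simp
qed (use coding_path in \<open>auto simp: space_M\<close>)

lemma std_domain_measurable: "l \<in> mor L \<Longrightarrow> std_domain L l \<in> sets M"
  using cylinder_measurable by (simp add: std_domain_def)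

lemma prefixing_measurable:
  assumes "l \<in> mor L"
  shows "pre l \<in> restrict_space M (std_domain L l) \<rightarrow>\<^sub>M M"
proof (rule measurable_into_M)
  have sp: "space (restrict_space M (std_domain L l)) = std_domain L l"
    using assms by (auto simp: space_restrict_space space_M std_domain_iff)
  show "pre l x \<in> X" if "x \<in> space (restrict_space M (std_domain L l))" for x
    using that prefixing_path[OF assms] by (simp add: sp)
  fix n
  have "{x \<in> std_domain L l. pre l x (0, deg L n) = n}
    = std_domain L l \<inter> {x \<in> X. seg (l \<cdot> x (0, deg L n)) 0 (deg L n) = n}"
    using prefixing_initial[OF assms] assms by (auto simp: std_domain_iff)
  then show "{x \<in> space (restrict_space M (std_domain L l)). pre l x (0, deg L n) = n}
    \<in> sets (restrict_space M (std_domain L l))"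
    using initial_segment_measurable[of "\<lambda>w. seg (l \<cdot> w) 0 (deg L n) = n"] std_domain_measurable[OF assms]
    by (auto simp: sp sets_restrict_space)
qed

lemma prefixing_image_eq:
  assumes "l \<in> mor L" "E \<subseteq> std_domain L l"
  shows "pre l ` E = Z l \<inter> (std_coding (deg L l) -` E \<inter> space M)"
  using prefixing_image[OF assms] cylinder_sub by (auto simp: space_M)

lemma prefixing_image_measurable:
  assumes "l \<in> mor L" "E \<subseteq> std_domain L l" "E \<in> sets M"
  shows "pre l ` E \<in> sets M"
  using prefixing_image_eq[OF assms(1,2)] cylinder_measurable[OF assms(1)]
    measurable_sets[OF coding_measurable assms(3)] by simp

end

section \<open>Radon--Nikodym derivatives of compositions\<close>

text \<open>
  The chain rule: \<open>d(M \<circ> s \<circ> t)/dM = (d(M \<circ> s)/dM \<circ> t) * d(M \<circ> t)/dM\<close>. The reason is that \<open>t\<close>, being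
  injective, transports the measure \<open>M \<circ> t\<close> to the restriction of \<open>M\<close> to the range of \<open>t\<close>, so that
  integrals over \<open>t ` E\<close> become integrals over \<open>E\<close>.
\<close>

lemma is_RN_deriv_comp_compose:
  assumes s: "is_RN_deriv_comp M (space M) s hs" and t: "is_RN_deriv_comp M (space M) t ht"
    and meas: "t \<in> M \<rightarrow>\<^sub>M M" and inj: "inj_on t (space M)"
    and st: "\<And>z. z \<in> space M \<Longrightarrow> st z = s (t z)"
  shows "is_RN_deriv_comp M (space M) st (\<lambda>z. hs (t z) * ht z)"
proof -
  have hs: "hs \<in> borel_measurable M" and ht: "ht \<in> borel_measurable M"
    using s t by (auto simp: is_RN_deriv_comp_def)
  have t_sp: "z \<in> space M \<Longrightarrow> t z \<in> space M" for z
    using meas by (auto simp: measurable_def)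
  have distr: "emeasure M (B \<inter> t ` space M) = emeasure (distr (density M ht) M t) B"
    if B: "B \<in> sets M" for B
  proof -
    have "t -` B \<inter> space M \<in> sets M"
      using meas B by (rule measurable_sets)
    then have "emeasure M (t ` (t -` B \<inter> space M)) = emeasure (density M ht) (t -` B \<inter> space M)"
      using t by (auto simp: is_RN_deriv_comp_def)
    moreover have "t ` (t -` B \<inter> space M) = B \<inter> t ` space M"
      by auto
    ultimately show ?thesis
      using B meas by (simp add: emeasure_distr)
  qed
  have R: "t ` space M \<in> sets M"
    using t by (auto simp: is_RN_deriv_comp_def)
  have pushed: "distr (density M ht) M t = density M (indicator (t ` space M))"
  proof (rule measure_eqI)
    fix B assume "B \<in> sets (distr (density M ht) M t)"
    then have B: "B \<in> sets M"
      by simp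
    have "emeasure (density M (indicator (t ` space M))) B = emeasure M (t ` space M \<inter> B)"
      using R B by (simp add: emeasure_restricted)
    then show "emeasure (distr (density M ht) M t) B = emeasure (density M (indicator (t ` space M))) B"
      using distr[OF B] by (simp add: Int_commute)
  qed simp
  show ?thesis
    unfolding is_RN_deriv_comp_def
  proof (intro conjI ballI impI)
    show hm: "(\<lambda>z. hs (t z) * ht z) \<in> borel_measurable M"
      using measurable_compose[OF meas hs] ht by auto
    fix E assume E: "E \<in> sets M" "E \<subseteq> space M"
    have tE: "t ` E \<in> sets M" "t ` E \<subseteq> space M"
      using t E t_sp by (auto simp: is_RN_deriv_comp_def)
    have st_E: "st ` E = s ` (t ` E)"
      using st E(2) by (force simp: image_image)
    show "st ` E \<in> sets M"
      using s tE by (auto simp: st_E is_RN_deriv_comp_def)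
    have "emeasure M (st ` E) = emeasure (density M hs) (t ` E)"
      using s tE by (auto simp: st_E is_RN_deriv_comp_def)
    also have "\<dots> = (\<integral>\<^sup>+z. hs z * indicator (t ` E) z \<partial>M)"
      using hs tE by (simp add: emeasure_density)
    also have "\<dots> = (\<integral>\<^sup>+z. indicator (t ` space M) z * (hs z * indicator (t ` E) z) \<partial>M)"
      using E(2) by (intro nn_integral_cong) (auto simp: indicator_def)
    also have "\<dots> = (\<integral>\<^sup>+z. hs z * indicator (t ` E) z \<partial>density M (indicator (t ` space M)))"
      using hs tE R by (subst nn_integral_density) auto
    also have "\<dots> = (\<integral>\<^sup>+z. hs (t z) * indicator (t ` E) (t z) \<partial>density M ht)"
      unfolding pushed[symmetric] using hs tE meas by (subst nn_integral_distr) auto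
    also have "\<dots> = (\<integral>\<^sup>+z. ht z * (hs (t z) * indicator (t ` E) (t z)) \<partial>M)"
    proof -
      have "(\<lambda>z. hs z * indicator (t ` E) z) \<in> borel_measurable M"
        using hs tE by auto
      from measurable_compose[OF meas this] show ?thesis
        using ht by (subst nn_integral_density) auto
    qed
    also have "\<dots> = (\<integral>\<^sup>+z. hs (t z) * ht z * indicator E z \<partial>M)"
      using inj E(2) by (intro nn_integral_cong)
        (auto simp: indicator_def ac_simps dest: inj_onD)
    also have "\<dots> = emeasure (density M (\<lambda>z. hs (t z) * ht z)) E"
      using hm E by (simp add: emeasure_density)
    finally show "emeasure M (st ` E) = emeasure (density M (\<lambda>z. hs (t z) * ht z)) E" .
  qed
qed

section \<open>The flip 2-graph\<close>

locale flip = kgraph L for L :: "('a, 2) graded_category" +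
  fixes v e :: 'a and f :: "nat \<Rightarrow> 'a"
  assumes flip: "flip_2graph L v e f"
begin

abbreviation word where "word \<equiv> ef_word L v e f"

lemma vertices: "l \<in> mor L \<Longrightarrow> deg L l = 0 \<longleftrightarrow> l = v" and v: "v \<in> mor L" "deg L v = 0"
  using flip by (auto simp: flip_2graph_def deg_set_def)

lemma edges: "e \<in> mor L" "f 1 \<in> mor L" "f 2 \<in> mor L" "deg L e = axis 2 1"
    "deg L (f 1) = axis 1 1" "deg L (f 2) = axis 1 1" "f 1 \<noteq> f 2"
  using flip by (auto simp: flip_2graph_def deg_set_def)

lemma edge_cases:
  "l \<in> mor L \<Longrightarrow> deg L l = axis 1 1 \<Longrightarrow> l = f 1 \<or> l = f 2"
  "l \<in> mor L \<Longrightarrow> deg L l = axis 2 1 \<Longrightarrow> l = e"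
  using flip by (auto simp: flip_2graph_def deg_set_def)

lemma one_vertex: "l \<in> mor L \<Longrightarrow> rng L l = v" "l \<in> mor L \<Longrightarrow> src L l = v"
  using vertices[of "rng L l"] vertices[of "src L l"] by simp_all

lemma composable_iff [simp]: "composable L a b \<longleftrightarrow> a \<in> mor L \<and> b \<in> mor L"
  by (auto simp: composable_def one_vertex)

lemma assoc: "a \<in> mor L \<Longrightarrow> b \<in> mor L \<Longrightarrow> c \<in> mor L \<Longrightarrow> a \<cdot> b \<cdot> c = a \<cdot> (b \<cdot> c)"
  by (simp add: comp_assoc)

lemma v_comp [simp]: "a \<in> mor L \<Longrightarrow> v \<cdot> a = a" "a \<in> mor L \<Longrightarrow> a \<cdot> v = a"
  using mor_ends(7,8)[of a] by (simp_all add: one_vertex)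

lemma domain_v: "l \<in> mor L \<Longrightarrow> std_domain L l = X"
  using path_simps(1,2)[of _ 0 0] vertices by (auto simp: std_domain_iff one_vertex vec_nat)

text \<open>
  Factorisation splits off an edge from any morphism of nonzero degree, so the three edges generate
  the category.
\<close>

lemma morphism_induct [consumes 1, case_names vertex edge]:
  assumes "l \<in> mor L" and "P v"
    and step: "\<And>g l. g \<in> {e, f 1, f 2} \<Longrightarrow> l \<in> mor L \<Longrightarrow> P l \<Longrightarrow> P (g \<cdot> l)"
  shows "P l"
  using assms(1)
proof (induction "\<Sum>i\<in>UNIV. deg L l $ i" arbitrary: l rule: less_induct)
  case less
  show ?case
  proof (cases "l = v")
    case True
    then show ?thesis
      using assms(2) by simp
  next
    case False
    then obtain i where i: "0 < deg L l $ i"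
      using vertices[OF less.prems] by (auto simp: vec_eq_iff)
    then have "deg L l = axis i 1 + (deg L l - axis i 1)"
      by (auto simp: vec_eq_iff axis_def)
    then obtain g l' where *: "g \<in> mor L" "l' \<in> mor L" "l = g \<cdot> l'" "deg L g = axis i 1"
      using factorE[OF less.prems] by (metis composable_iff)
    have "g \<in> {e, f 1, f 2}"
      using edge_cases[OF *(1)] *(4) exhaust_2[of i] by auto
    moreover have "(\<Sum>i\<in>UNIV. deg L l' $ i) < (\<Sum>i\<in>UNIV. deg L l $ i)"
      using * by (simp add: sum.distrib axis_def)
    ultimately show ?thesis
      using step[of g l'] less.hyps[of l'] * by auto
  qed
qed

text \<open>
  A morphism of degree \<open>n\<close> is a product of as many edges as the sum of the entries of \<open>n\<close> says, and
  there are only finitely many such products.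
\<close>

lemma finite_degree: "finite (deg_set L n)"
proof -
  let ?S = "{gs. set gs \<subseteq> {e, f 1, f 2} \<and> length gs = (\<Sum>i\<in>UNIV. n $ i)}"
  have edge_deg: "g \<in> {e, f 1, f 2} \<Longrightarrow> g \<in> mor L \<and> (\<Sum>i\<in>UNIV. deg L g $ i) = 1" for g
    using edges by (auto simp: axis_def)
  have "\<exists>gs. set gs \<subseteq> {e, f 1, f 2} \<and> length gs = (\<Sum>i\<in>UNIV. deg L l $ i) \<and> l = foldr (cmp L) gs v"
    if "l \<in> mor L" for l
    using that
  proof (induction rule: morphism_induct)
    case vertex
    then show ?case
      using v by (intro exI[of _ "[]"]) auto
  next
    case (edge g l)
    then obtain gs where gs: "set gs \<subseteq> {e, f 1, f 2}" "length gs = (\<Sum>i\<in>UNIV. deg L l $ i)"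
      "l = foldr (cmp L) gs v"
      by blast
    have "length (g # gs) = (\<Sum>i\<in>UNIV. deg L (g \<cdot> l) $ i)"
      using edge_deg[OF edge(1)] gs(2) edge(2) by (simp add: sum.distrib)
    then show ?case
      using gs edge(1) by (intro exI[of _ "g # gs"]) auto
  qed
  then have "deg_set L n \<subseteq> (\<lambda>gs. foldr (cmp L) gs v) ` ?S"
    by (force simp: deg_set_def)
  then show ?thesis
    by (rule finite_subset) (intro finite_imageI finite_lists_length_eq, simp)
qed

section \<open>Words in the edges of the flip 2-graph\<close>

abbreviation bits :: "nat list \<Rightarrow> bool" where "bits as \<equiv> set as \<subseteq> {0, 1}"

lemma word_Nil [simp]: "word [] = v" and word_Cons [simp]: "word (a # as) = e \<cdot> f (a + 1) \<cdot> word as"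
  by (simp_all add: ef_word_def)

lemma f_bit: "a \<in> {0, 1} \<Longrightarrow> f (a + 1) \<in> mor L \<and> deg L (f (a + 1)) = axis 1 1"
  using edges by (auto simp: numeral_2_eq_2)

lemma f_e: "a \<in> {0, 1} \<Longrightarrow> f (a + 1) \<cdot> e = e \<cdot> f (1 - a + 1)"
  using flip by (auto simp: flip_2graph_def numeral_2_eq_2)

lemma e_f: "a \<in> {0, 1} \<Longrightarrow> e \<cdot> f (a + 1) = f (1 - a + 1) \<cdot> e"
  using flip by (auto simp: flip_2graph_def numeral_2_eq_2)

lemma axis_sum: "axis 2 1 + axis 1 1 = (vec 1 :: nat ^ 2)"
  by (auto simp: vec_eq_iff axis_def forall_2)

lemma word_mor: "bits as \<Longrightarrow> word as \<in> mor L \<and> deg L (word as) = vec (length as)"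
proof (induction as)
  case Nil
  then show ?case
    using v by (simp add: vec_eq_iff)
next
  case (Cons a as)
  then show ?case
    using f_bit[of a] edges axis_sum by (auto simp: vec_eq_iff)
qed

text \<open>
  Factorisation into pieces of degree \<open>(1, 1)\<close>, each of which is \<open>e\<close> followed by some \<open>f\<^sub>i\<close>.
\<close>

lemma word_ex:
  assumes "l \<in> mor L" "deg L l = vec n"
  shows "\<exists>as. bits as \<and> length as = n \<and> l = word as"
  using assms
proof (induction n arbitrary: l)
  case 0
  then show ?case
    using vertices[of l] by (intro exI[of _ "[]"]) (simp add: vec_eq_iff)
next
  case (Suc n)
  have "deg L l = vec 1 + vec n"
    using Suc by (simp add: vec_eq_iff)
  then obtain g l' where g: "g \<in> mor L" "l' \<in> mor L" "l = g \<cdot> l'" "deg L g = vec 1" "deg L l' = vec n"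
    using factorE[OF Suc.prems(1)] by (metis composable_iff)
  obtain e' f' where h: "e' \<in> mor L" "f' \<in> mor L" "g = e' \<cdot> f'" "deg L e' = axis 2 1" "deg L f' = axis 1 1"
    using factorE[OF g(1), of "axis 2 1" "axis 1 1"] g(4) axis_sum by (metis composable_iff)
  have "e' = e"
    using edge_cases(2) h by blast
  moreover have "\<exists>a \<in> {0, 1}. f' = f (a + 1)"
    using edge_cases(1)[of f'] h by (auto simp: numeral_2_eq_2)
  ultimately obtain a where a: "a \<in> {0, 1}" "g = e \<cdot> f (a + 1)"
    using h by auto
  obtain as where "bits as" "length as = n" "l' = word as"
    using Suc.IH[OF g(2,5)] by blast
  then show ?case
    using a g(3) by (intro exI[of _ "a # as"]) auto
qed

definition neg :: "nat list \<Rightarrow> nat list" where "neg = map (\<lambda>a. 1 - a)"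

lemma neg_simps [simp]: "neg [] = []" "neg (a # as) = (1 - a) # neg as" "length (neg as) = length as"
    "set (neg as) \<subseteq> {0, Suc 0}"
  by (auto simp: neg_def)

text \<open>
  Moving \<open>e\<close> past an edge \<open>f\<^sub>i\<close> interchanges \<open>f\<^sub>1\<close> and \<open>f\<^sub>2\<close>, so moving it from the front of a word to
  its end complements all bits.
\<close>

lemma e_word: "bits as \<Longrightarrow> e \<cdot> word as = word (neg as) \<cdot> e"
proof (induction as)
  case Nil
  then show ?case
    using edges by simp
next
  case (Cons a as)
  have m: "e \<in> mor L" "f (a + 1) \<in> mor L" "f (1 - a + 1) \<in> mor L" "word as \<in> mor L" "word (neg as) \<in> mor L"
    using edges f_bit[of a] f_bit[of "1 - a"] Cons word_mor[of as] word_mor[of "neg as"] by auto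
  have "e \<cdot> word (a # as) = e \<cdot> (e \<cdot> f (a + 1)) \<cdot> word as"
    using m by (simp add: assoc)
  also have "\<dots> = e \<cdot> f (1 - a + 1) \<cdot> (e \<cdot> word as)"
    using m e_f[of a] Cons.prems by (simp add: assoc)
  also have "\<dots> = word (neg (a # as)) \<cdot> e"
    using m Cons by (simp add: assoc)
  finally show ?case .
qed

text \<open>
  In \<open>f\<^sub>i e f\<^sub>j e \<cdots> e\<close> every \<open>f\<close> is followed by an \<open>e\<close>. Interchanging each such pair
  turns the product into a word that is one letter longer. The factor \<open>e\<close> at the end serves the
  last letter; it does not change the cylinder, by \<open>cylinder_e\<close>.
\<close>

lemma f_word:
  "bits as \<Longrightarrow> b \<in> {0, 1} \<Longrightarrow> f (b + 1) \<cdot> word as \<cdot> e = word ((1 - b) # neg as)"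
proof (induction as arbitrary: b)
  case Nil
  then show ?case
    using edges f_bit[of b] f_bit[of "1 - b"] f_e[of b] by auto
next
  case (Cons a as)
  have m: "e \<in> mor L" "f (a + 1) \<in> mor L" "f (1 - b + 1) \<in> mor L" "f (b + 1) \<in> mor L" "word as \<in> mor L"
    using edges f_bit[of a] f_bit[of b] f_bit[of "1 - b"] Cons word_mor[of as] by auto
  have "f (b + 1) \<cdot> word (a # as) \<cdot> e = f (b + 1) \<cdot> e \<cdot> (f (a + 1) \<cdot> word as \<cdot> e)"
    using m by (simp add: assoc)
  also have "\<dots> = e \<cdot> f (1 - b + 1) \<cdot> word ((1 - a) # neg as)"
    using f_e[OF Cons.prems(2)] Cons by simp
  finally show ?case
    by simp
qed

text \<open>
  Every infinite path with initial segment \<open>l\<close> passes through \<open>l \<cdot> e\<close>, since \<open>e\<close> is the only edge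
  of its degree.
\<close>

lemma cylinder_e:
  assumes "l \<in> mor L"
  shows "Z (l \<cdot> e) = Z l"
proof -
  have "x (0, deg L e) = e" if "x \<in> X" for x
    using edge_cases(2)[of "x (0, deg L e)"] path_simps(1,2)[OF that, of 0 "deg L e"] edges(4)
    by (simp add: vec_nat)
  then have "Z e = X"
    by (auto simp: cylinder_def)
  then show ?thesis
    using cylinder_comp_iff[of l e] edges assms coding_path cylinder_sub[of l] by auto
qed

lemma prefix_e_word: "bits as \<Longrightarrow> pre e ` Z (word as) = Z (word (neg as))"
  using prefixing_cylinder[of e "word as"] e_word[of as] cylinder_e[of "word (neg as)"]
    edges word_mor[of as] word_mor[of "neg as"] by simp

lemma prefix_f_word:
  assumes "bits as" "b \<in> {0, 1}"
  shows "pre (f (b + 1)) ` Z (word as) = Z (word ((1 - b) # neg as))"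
  using prefixing_cylinder[of "f (b + 1)" "word as"] f_word[OF assms]
    cylinder_e[of "f (b + 1) \<cdot> word as"] edges word_mor[OF assms(1)] f_bit[OF assms(2)] by simp

section \<open>Cylinders of words generate the Borel sets\<close>

lemma path_word:
  assumes "x \<in> X"
  obtains as where "bits as" "length as = n" "x (0, vec n) = word as"
  using word_ex[of "x (0, vec n)" n] path_simps(1,2)[OF assms, of 0 "vec n"] by (auto simp: vec_nat)

lemma cylinder_word_iff: "bits as \<Longrightarrow> x \<in> Z (word as) \<longleftrightarrow> x \<in> X \<and> x (0, vec (length as)) = word as"
  using word_mor[of as] by (auto simp: cylinder_def)

lemma cylinder_word_nested:
  assumes "bits as" "bits bs" "length as \<le> length bs" "Z (word as) \<inter> Z (word bs) \<noteq> {}"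
  shows "Z (word bs) \<subseteq> Z (word as)"
proof
  obtain x where x: "x \<in> X" "x (0, vec (length as)) = word as" "x (0, vec (length bs)) = word bs"
    using assms by (auto simp: cylinder_word_iff)
  have le: "vec (length as) \<le> (vec (length bs) :: nat ^ 2)"
    using assms(3) by (simp add: less_eq_vec_def)
  fix y assume "y \<in> Z (word bs)"
  then have y: "y \<in> X" "y (0, vec (length bs)) = word bs"
    using assms by (auto simp: cylinder_word_iff)
  show "y \<in> Z (word as)"
    using path_seg[OF x(1) vec_nat_zero_le le] path_seg[OF y(1) vec_nat_zero_le le] x y
      cylinder_word_iff[OF assms(1), of y] by simp
qed

text \<open>
  The empty set is included for stability under intersection. The empty word is left out: its
  cylinder is the whole space, of measure 2, to which the product formula does not apply.
\<close>

definition word_cylinders where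
  "word_cylinders = insert {} {Z (word as) |as. bits as \<and> as \<noteq> []}"

lemma Int_stable_word_cylinders: "Int_stable word_cylinders"
proof (rule Int_stableI)
  fix A B assume AB: "A \<in> word_cylinders" "B \<in> word_cylinders"
  show "A \<inter> B \<in> word_cylinders"
  proof (cases "A \<inter> B = {}")
    case False
    then obtain as bs where *: "A = Z (word as)" "bits as" "B = Z (word bs)" "bits bs"
      using AB by (auto simp: word_cylinders_def)
    have "A \<inter> B = A \<or> A \<inter> B = B"
      using cylinder_word_nested[of as bs] cylinder_word_nested[of bs as] * False
      by (metis Int_absorb1 Int_absorb2 Int_commute linear)
    then show ?thesis
      using AB by metis
  qed (simp add: word_cylinders_def)
qed

lemma countable_word_cylinders: "countable word_cylinders"
proof -
  have "word_cylinders \<subseteq> insert {} ((\<lambda>as. Z (word as)) ` UNIV)"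
    by (auto simp: word_cylinders_def)
  then show ?thesis
    by (rule countable_subset) (intro countable_insert countable_image countableI_type)
qed

text \<open>
  For \<open>n\<close> large, the segment \<open>x (0, (n, n))\<close> determines \<open>x (0, deg L l)\<close>, so the cylinder of
  \<open>l\<close> is a union of cylinders of words.
\<close>

lemma sets_word_cylinders: "sets (path_borel L) = sigma_sets X word_cylinders"
  unfolding sets_path_borel
proof (rule sigma_sets_eqI)
  fix U assume "U \<in> word_cylinders"
  then show "U \<in> sigma_sets X (Z ` mor L)"
    using word_mor by (auto simp: word_cylinders_def intro: sigma_sets.Empty)
next
  interpret S: sigma_algebra X "sigma_sets X word_cylinders"
    by (rule sigma_algebra_sigma_sets) (use cylinder_sub in \<open>auto simp: word_cylinders_def\<close>)
  fix U assume "U \<in> Z ` mor L"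
  then obtain l where l: "l \<in> mor L" "U = Z l"
    by auto
  \<comment> \<open>\<open>Suc\<close> makes the words nonempty also when \<open>l\<close> is the vertex.\<close>
  define n where "n = Suc (\<Sum>i\<in>UNIV. deg L l $ i)"
  have le: "deg L l \<le> vec n"
    by (auto simp: n_def less_eq_vec_def intro!: le_SucI member_le_sum)
  have "U = \<Union>{W \<in> word_cylinders. W \<subseteq> U}"
  proof (intro subset_antisym subsetI)
    fix x assume x: "x \<in> U"
    then have xX: "x \<in> X" "x (0, deg L l) = l"
      using l by (auto simp: cylinder_def)
    obtain as where as: "bits as" "length as = n" "x (0, vec n) = word as"
      using path_word[OF xX(1)] .
    have "Z (word as) \<subseteq> U"
    proof
      fix y assume "y \<in> Z (word as)"
      then have y: "y \<in> X" "y (0, vec n) = x (0, vec n)"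
        using as by (auto simp: cylinder_word_iff)
      then show "y \<in> U"
        using path_seg[OF xX(1) vec_nat_zero_le le] path_seg[OF y(1) vec_nat_zero_le le] xX l
        by (simp add: cylinder_def)
    qed
    moreover have "x \<in> Z (word as)" "as \<noteq> []"
      using as xX by (auto simp: cylinder_word_iff n_def)
    ultimately show "x \<in> \<Union>{W \<in> word_cylinders. W \<subseteq> U}"
      using as(1) by (auto simp: word_cylinders_def)
  qed auto
  also have "\<dots> \<in> sigma_sets X word_cylinders"
    using S.countable_UN'[of "{W \<in> word_cylinders. W \<subseteq> U}" "\<lambda>W. W"] countable_word_cylinders
    by (auto intro: countable_subset)
  finally show "U \<in> sigma_sets X word_cylinders" .
qed

end

section \<open>The Markov measure\<close>

locale flip_measure = flip L v e f + kgraph_measure L M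
  for L :: "('a, 2) graded_category" and v e :: 'a and f :: "nat \<Rightarrow> 'a"
    and M :: "('a, 2) path measure" +
  fixes x :: real
  assumes x01: "0 < x" "x < 1" and mu: "is_mu L v e f x M"
begin

abbreviation T where "T \<equiv> T_matrix x"
abbreviation weight where "weight \<equiv> markov_weight (\<lambda>i. 1) T"

lemma T_pos: "a \<in> {0, 1} \<Longrightarrow> b \<in> {0, 1} \<Longrightarrow> 0 < T a b"
  using x01 by (auto simp: T_matrix_def)

lemma T_neg: "a \<in> {0, 1} \<Longrightarrow> b \<in> {0, 1} \<Longrightarrow> T (1 - a) (1 - b) = T a b"
  by (auto simp: T_matrix_def)

lemma weight_single: "weight [a] = 1"
  by (simp add: markov_weight_def)

lemma weight_Cons: "weight (a # b # as) = T a b * weight (b # as)"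
  by (simp add: markov_weight_def prod.lessThan_Suc_shift del: prod.lessThan_Suc)

lemma weight_pos: "bits as \<Longrightarrow> as \<noteq> [] \<Longrightarrow> 0 < weight as"
proof (induction as rule: induct_list012)
  case (3 a b as)
  then show ?case
    using T_pos[of a b] by (simp add: weight_Cons)
qed (simp_all add: weight_single)

lemma weight_neg: "bits as \<Longrightarrow> weight (neg as) = weight as"
proof (induction as rule: induct_list012)
  case (3 a b as)
  then show ?case
    using T_neg[of a b] by (simp add: weight_Cons)
qed (simp_all add: weight_single)

lemma emeasure_word: "bits as \<Longrightarrow> as \<noteq> [] \<Longrightarrow> emeasure M (Z (word as)) = ennreal (weight as)"
  using mu by (auto simp: is_mu_def)

lemma word_measurable: "bits as \<Longrightarrow> Z (word as) \<in> sets M"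
  using cylinder_measurable word_mor by blast

lemma first_letters_cover: "Z (word [0]) \<union> Z (word [1]) = X"
proof
  show "X \<subseteq> Z (word [0]) \<union> Z (word [1])"
  proof
    fix z assume z: "z \<in> X"
    obtain as where as: "bits as" "length as = 1" "z (0, vec 1) = word as"
      using path_word[OF z] .
    then obtain a where "as = [a]" "a \<in> {0, 1}"
      by (auto simp: length_Suc_conv)
    then show "z \<in> Z (word [0]) \<union> Z (word [1])"
      using as z cylinder_word_iff[of as z] by auto
  qed
qed (use cylinder_sub in auto)

lemma first_letter:
  assumes "bits (a # as)" "z \<in> Z (word (a # as))"
  shows "z (0, vec 1) = word [a]"
proof -
  have m: "e \<cdot> f (a + 1) \<in> mor L" "word as \<in> mor L"
    using assms edges f_bit[of a] word_mor[of as] by auto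
  have "z \<in> Z (word [a])"
    using cylinder_comp_iff[of "e \<cdot> f (a + 1)" "word as" z] assms(2) m by simp
  then show ?thesis
    using cylinder_word_iff[of "[a]" z] assms(1) by simp
qed

lemma words_01: "word [0] \<noteq> word [1]"
  using factor_unique[of e "f 1" e "f 2"] edges by (auto simp: numeral_2_eq_2)

text \<open>
  If prefixing by \<open>g\<close> scales the measure of each cylinder of a word by a factor that depends on the
  first letter only, then this factor, as a function of the point, is the derivative: two measures
  which agree on the intersection-stable generator \<open>word_cylinders\<close> are equal. The difference
  quotients at a point are constant from the first letter on, so their limit is this factor.
\<close>

lemma derivative_from_words:
  fixes c :: "nat \<Rightarrow> real"
  assumes g: "g \<in> mor L" and c: "0 < c 0" "0 < c 1"
    and scale: "\<And>as. bits as \<Longrightarrow> as \<noteq> [] \<Longrightarrow>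
      emeasure M (pre g ` Z (word as)) = ennreal (c (hd as)) * emeasure M (Z (word as))"
  shows "\<exists>h. is_RN_deriv_comp M X (pre g) h \<and>
    (\<forall>z \<in> X. 0 < h z \<and> h z < \<infinity> \<and> has_cylinder_deriv_at L M (pre g) z (h z))"
proof -
  define h where "h z = (if z (0, vec 1) = word [0] then ennreal (c 0) else ennreal (c 1))"
    for z :: "('a, 2) path"
  have h: "h z = ennreal (c (hd as))" if "bits as" "as \<noteq> []" "z \<in> Z (word as)" for z as
    using that first_letter[of "hd as" "tl as" z] words_01 by (cases as) (auto simp: h_def)
  have "{z \<in> X. z (0, vec 1) = word [0]} \<in> sets M"
    by (rule initial_segment_measurable)
  then have "{z \<in> space M. z (0, vec 1) = word [0]} \<in> sets M"
    by (simp add: space_M)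
  then have hm: "h \<in> borel_measurable M"
    unfolding h_def by (intro measurable_If) simp_all
  \<comment> \<open>The measure \<open>E \<mapsto> M (pre g ` E)\<close>, as the image under coding of \<open>M\<close> restricted to \<open>Z g\<close>.\<close>
  define N where "N = distr (density M (indicator (Z g))) M (std_coding (deg L g))"
  have cod: "std_coding (deg L g) \<in> density M (indicator (Z g)) \<rightarrow>\<^sub>M M"
    using coding_measurable by simp
  have N: "emeasure N E = emeasure M (pre g ` E)" if E: "E \<in> sets M" for E
  proof -
    have "E \<subseteq> std_domain L g"
      using sets.sets_into_space[OF E] by (simp add: domain_v[OF g] space_M)
    then show ?thesis
      using E cod cylinder_measurable[OF g] measurable_sets[OF coding_measurable E]
      by (simp add: N_def emeasure_distr emeasure_restricted prefixing_image_eq[OF g])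
  qed
  have words: "emeasure (density M h) (Z (word as)) = ennreal (c (hd as)) * emeasure M (Z (word as))"
    if "bits as" "as \<noteq> []" for as
  proof -
    have "emeasure (density M h) (Z (word as)) = (\<integral>\<^sup>+z. h z * indicator (Z (word as)) z \<partial>M)"
      using hm word_measurable[OF that(1)] by (simp add: emeasure_density)
    also have "\<dots> = (\<integral>\<^sup>+z. ennreal (c (hd as)) * indicator (Z (word as)) z \<partial>M)"
      using h[OF that] by (intro nn_integral_cong) (auto simp: indicator_def)
    also have "\<dots> = ennreal (c (hd as)) * emeasure M (Z (word as))"
      using word_measurable[OF that(1)] by (simp add: nn_integral_cmult_indicator)
    finally show ?thesis .
  qed
  have sets: "sets M = sigma_sets X word_cylinders"
    using sets_M sets_word_cylinders by simp
  have "density M h = N"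
  proof (rule measure_eqI_generator_eq_countable[where A = "{Z (word [0]), Z (word [1])}"])
    show "Int_stable word_cylinders"
      by (rule Int_stable_word_cylinders)
    show "word_cylinders \<subseteq> Pow X"
      using cylinder_sub by (auto simp: word_cylinders_def)
    show "emeasure (density M h) W = emeasure N W" if W: "W \<in> word_cylinders" for W
    proof (cases "W = {}")
      case False
      then obtain as where "W = Z (word as)" "bits as" "as \<noteq> []"
        using W by (auto simp: word_cylinders_def)
      then show ?thesis
        using words[of as] scale[of as] N[of W] word_measurable by simp
    qed simp
    show "sets (density M h) = sigma_sets X word_cylinders" "sets N = sigma_sets X word_cylinders"
      by (simp_all add: sets N_def)
    have "bits [0]" "bits [1]"
      by auto
    then show "{Z (word [0]), Z (word [1])} \<subseteq> word_cylinders"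
      unfolding word_cylinders_def by blast
    show "\<Union>{Z (word [0]), Z (word [1])} = X"
      using first_letters_cover by simp
    show "emeasure (density M h) W \<noteq> \<infinity>" if "W \<in> {Z (word [0]), Z (word [1])}" for W
      using that words[of "[0]"] words[of "[1]"] emeasure_word[of "[0]"] emeasure_word[of "[1]"]
      by (auto simp: weight_single ennreal_mult_eq_top_iff)
  qed simp
  then have "is_RN_deriv_comp M X (pre g) h"
    unfolding is_RN_deriv_comp_def
    using hm N prefixing_image_measurable[OF g] domain_v[OF g] by auto
  moreover have "0 < h z \<and> h z < \<infinity> \<and> has_cylinder_deriv_at L M (pre g) z (h z)" if z: "z \<in> X" for z
  proof (intro conjI)
    show "0 < h z" "h z < \<infinity>"
      using c by (auto simp: h_def)
    have "emeasure M (pre g ` Z (z (0, vec n))) / emeasure M (Z (z (0, vec n))) = h z"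
      if n: "1 \<le> n" for n
    proof -
      obtain as where as: "bits as" "length as = n" "z (0, vec n) = word as"
        using path_word[OF z] .
      then have ne: "as \<noteq> []"
        using n by auto
      have "h z = ennreal (c (hd as))"
        using h[OF as(1) ne] as z by (simp add: cylinder_word_iff)
      then show ?thesis
        using scale[OF as(1) ne] emeasure_word[OF as(1) ne] weight_pos[OF as(1) ne] as(3)
        by (simp add: ennreal_mult_divide_eq)
    qed
    then show "has_cylinder_deriv_at L M (pre g) z (h z)"
      unfolding has_cylinder_deriv_at_def
      by (intro tendsto_eventually eventually_sequentiallyI[of 1]) auto
  qed
  ultimately show ?thesis
    by blast
qed

text \<open>
  Prefixing by \<open>e\<close> complements the bits, which preserves all transition weights. Prefixing
  by \<open>f (b + 1)\<close> complements the bits and puts \<open>1 - b\<close> in front, which contributes the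
  transition weight from \<open>1 - b\<close> to \<open>1 - a\<close>, where \<open>a\<close> is the first bit; this is \<open>T b a\<close>.
\<close>

lemma edge_derivatives:
  assumes "g \<in> {e, f 1, f 2}"
  shows "\<exists>h. is_RN_deriv_comp M X (pre g) h \<and>
    (\<forall>z \<in> X. 0 < h z \<and> h z < \<infinity> \<and> has_cylinder_deriv_at L M (pre g) z (h z))"
proof -
  have F: ?thesis if g: "g = f (b + 1)" and b: "b \<in> {0, 1}" for b
  proof (rule derivative_from_words[where c = "T b"])
    show "g \<in> mor L"
      using f_bit[OF b] g by simp
    show "0 < T b 0" "0 < T b 1"
      using T_pos[OF b] by auto
    fix as assume as: "bits as" "as \<noteq> []"
    then obtain a as' where a: "as = a # as'" "a \<in> {0, 1}"
      by (cases as) auto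
    have ne: "bits ((1 - b) # neg as)"
      by auto
    have "weight ((1 - b) # neg as) = T b a * weight as"
      using T_neg[OF b a(2)] weight_neg[OF as(1)] a(1) by (simp add: weight_Cons)
    then show "emeasure M (pre g ` Z (word as)) = ennreal (T b (hd as)) * emeasure M (Z (word as))"
      using prefix_f_word[OF as(1) b] emeasure_word[OF ne] emeasure_word[OF as] g a
        T_pos[OF b a(2)] weight_pos[OF as] by (simp add: ennreal_mult)
  qed
  show ?thesis
  proof (cases "g = e")
    case True
    show ?thesis
    proof (rule derivative_from_words[where c = "\<lambda>_. 1"])
      fix as assume as: "bits as" "as \<noteq> []"
      then have "neg as \<noteq> []" "bits (neg as)"
        by (auto simp: neg_def)
      then show "emeasure M (pre g ` Z (word as)) = ennreal 1 * emeasure M (Z (word as))"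
        using prefix_e_word[OF as(1)] emeasure_word[of "neg as"] emeasure_word[OF as] weight_neg[OF as(1)]
          True by simp
    qed (use True edges in auto)
  next
    case False
    then show ?thesis
      using assms F[of 0] F[of 1] by (auto simp: numeral_2_eq_2)
  qed
qed

lemma prefixing_measurable_total:
  assumes "l \<in> mor L"
  shows "pre l \<in> M \<rightarrow>\<^sub>M M"
proof -
  have "A \<in> sets (restrict_space M (space M)) \<longleftrightarrow> A \<in> sets M" for A
    using sets_restrict_space_iff[of "space M" M A] sets.sets_into_space[of A M] by auto
  then have "sets (restrict_space M (space M)) = sets M"
    by blast
  then have "restrict_space M X \<rightarrow>\<^sub>M M = M \<rightarrow>\<^sub>M M"
    using measurable_cong_sets[of "restrict_space M X" M M M] by (simp add: space_M)
  then show ?thesis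
    using prefixing_measurable[OF assms] unfolding domain_v[OF assms] by blast
qed

lemma derivatives:
  assumes "l \<in> mor L"
  shows "\<exists>h. is_RN_deriv_comp M X (pre l) h \<and> (\<forall>z \<in> X. 0 < h z)"
  using assms
proof (induction rule: morphism_induct)
  case vertex
  have pre_v: "pre v ` E = E" if "E \<subseteq> X" for E
    using prefixing_vertex[OF v] domain_v[OF v(1)] that by (force simp: image_iff)
  have "is_RN_deriv_comp M X (pre v) (\<lambda>_. 1)"
    unfolding is_RN_deriv_comp_def by (auto simp: pre_v density_1)
  then show ?case
    by (intro exI[of _ "\<lambda>_. 1"]) auto
next
  case (edge g l)
  have g: "g \<in> mor L"
    using edge(1) edges by auto
  obtain hg where hg: "is_RN_deriv_comp M (space M) (pre g) hg" "\<And>z. z \<in> X \<Longrightarrow> 0 < hg z"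
    using edge_derivatives[OF edge(1)] by (auto simp: space_M)
  obtain hl where hl: "is_RN_deriv_comp M (space M) (pre l) hl" "\<And>z. z \<in> X \<Longrightarrow> 0 < hl z"
    using edge by (auto simp: space_M)
  have "is_RN_deriv_comp M (space M) (pre (g \<cdot> l)) (\<lambda>z. hg (pre l z) * hl z)"
  proof (rule is_RN_deriv_comp_compose[OF hg(1) hl(1) prefixing_measurable_total[OF edge(2)]])
    show "inj_on (pre l) (space M)"
      by (rule inj_on_inverseI[where g = "std_coding (deg L l)"])
        (simp add: prefixing(2) edge(2) domain_v space_M)
    show "pre (g \<cdot> l) z = pre g (pre l z)" if "z \<in> space M" for z
      using prefixing_comp(2)[of g l z] that g edge(2) domain_v by (auto simp: space_M)
  qed
  moreover have "0 < hg (pre l z) * hl z" if "z \<in> X" for z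
    using hg(2) hl(2) that prefixing_path[OF edge(2)] domain_v[OF edge(2)]
    by (simp add: ennreal_zero_less_mult_iff)
  ultimately show ?case
    by (auto simp: space_M)
qed

lemma semibranching: "semibranching_function_system M (deg_set L m) (std_domain L) pre"
  unfolding semibranching_function_system_def
proof (intro conjI ballI impI)
  have R: "pre i ` std_domain L i = {x \<in> X. x (0, m) = i}" if "i \<in> deg_set L m" for i
    using that prefixing_range[of i] by (auto simp: deg_set_def cylinder_def)
  show "finite (deg_set L m)"
    by (rule finite_degree)
  show "std_domain L i \<in> sets M" "pre i \<in> restrict_space M (std_domain L i) \<rightarrow>\<^sub>M M"
    if "i \<in> deg_set L m" for i
    using that std_domain_measurable prefixing_measurable by (auto simp: deg_set_def)
  have "space M - (\<Union>i\<in>deg_set L m. pre i ` std_domain L i) = {}"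
    using path_simps(1,2)[of _ 0 m] by (auto simp: R space_M deg_set_def vec_nat)
  then show "emeasure M (space M - (\<Union>i\<in>deg_set L m. pre i ` std_domain L i)) = 0"
    by (metis emeasure_empty)
  show "emeasure M (pre i ` std_domain L i \<inter> pre j ` std_domain L j) = 0"
    if "i \<in> deg_set L m" "j \<in> deg_set L m" "i \<noteq> j" for i j
  proof -
    have "pre i ` std_domain L i \<inter> pre j ` std_domain L j = {}"
      using that by (auto simp: R)
    then show ?thesis
      by simp
  qed
  show "\<exists>h. is_RN_deriv_comp M (std_domain L i) (pre i) h \<and> (AE z in M. z \<in> std_domain L i \<longrightarrow> 0 < h z)"
    if "i \<in> deg_set L m" for i
    using that derivatives[of i] domain_v[of i] by (auto simp: deg_set_def)
qed

lemma Lambda_semibranching: "Lambda_semibranching_function_system L M (std_domain L) pre std_coding"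
  unfolding Lambda_semibranching_function_system_def
proof (intro conjI allI ballI impI)
  show "finite_k_graph L"
    using k_graph finite_degree by (simp add: finite_k_graph_def)
  show "semibranching_function_system M (deg_set L m) (std_domain L) pre" for m
    by (rule semibranching)
  show "coding_map M (deg_set L m) (std_domain L) pre (std_coding m)" for m
    using coding_measurable prefixing(2) by (auto simp: coding_map_def deg_set_def)
  show "pre w z = z" if "w \<in> vertices L" "z \<in> std_domain L w" for w z
    using that prefixing_vertex by (auto simp: deg_set_def)
  show "0 < emeasure M (std_domain L w)" if "w \<in> vertices L" for w
  proof -
    have "0 < emeasure M (Z (word [0]))"
      using emeasure_word[of "[0]"] by (simp add: weight_single)
    also have "\<dots> \<le> emeasure M X"
      using cylinder_sub sets.top[of M] by (intro emeasure_mono) (auto simp: space_M)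
    finally show ?thesis
      using that domain_v by (simp add: deg_set_def)
  qed
  fix l n assume ln: "composable L l n"
  then have m: "l \<in> mor L" "n \<in> mor L" "l \<cdot> n \<in> mor L"
    by auto
  have into: "pre n z \<in> std_domain L l" if "z \<in> std_domain L n" for z
    using prefixing_comp(1)[OF ln that] .
  then have "pre n ` std_domain L n - std_domain L l = {}"
    by auto
  then show "emeasure M (pre n ` std_domain L n - std_domain L l) = 0"
    by (metis emeasure_empty)
  show "AE z in M. (z \<in> std_domain L n \<and> pre n z \<in> std_domain L l \<longleftrightarrow> z \<in> std_domain L (l \<cdot> n)) \<and>
      (z \<in> std_domain L (l \<cdot> n) \<longrightarrow> pre l (pre n z) = pre (l \<cdot> n) z)"
    using into prefixing_comp(2)[OF ln] std_domain_comp[OF ln] by auto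
next
  show "std_coding m (std_coding n z) = std_coding (m + n) z" for m n z
    by (rule coding_coding)
qed

end

theorem proposition4p5:
  fixes L :: "('a, 2) graded_category" and v e :: 'a and f :: "nat \<Rightarrow> 'a"
    and x :: real and \<mu> :: "('a, 2) path measure"
  assumes "flip_2graph L v e f"
    and "0 < x" and "x < 1"
    and "is_mu L v e f x \<mu>"
  shows "(\<forall>g \<in> {e, f 1, f 2}. \<exists>h. is_RN_deriv_comp \<mu> (std_domain L g) (std_prefixing L g) h \<and>
            (\<forall>z \<in> inf_paths L. 0 < h z \<and> h z < \<infinity> \<and>
               has_cylinder_deriv_at L \<mu> (std_prefixing L g) z (h z))) \<and>
         Lambda_semibranching_function_system L \<mu> (std_domain L) (std_prefixing L) std_coding"
proof -
  interpret flip_measure L v e f \<mu> x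
    using assms by unfold_locales (auto simp: flip_2graph_def is_mu_def)
  have "std_domain L g = inf_paths L" if "g \<in> {e, f 1, f 2}" for g
    using that domain_v edges by auto
  then show ?thesis
    using edge_derivatives Lambda_semibranching by (intro conjI ballI) auto
qed

end
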